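(* Let $m\ge 3$ be an integer. For every integer $N\ge 0$ let $H_N=\det\left(\gamma^{(2m)}_{i+j+3-m}(t)\right)_{i,j=0}^{N-1}$ (with $H_0=1$). Then $$H_N=\begin{cases}\xi_1\, t^{m^2n(n-1)/2}\,[n+1]_{t^m}^2, & \text{if } N=mn \text{ with } n\ge 0,\\ (-1)^{m-1}\xi_1\, t^{m(n-1)(mn-2)/2}\,R(m;t,n-1), & \text{if } N=mn-1 \text{ with } n\ge 1,\\ -\xi_1\, t^{m(n-1)(mn-4)/2}\,[n]_{t^m}^2, & \text{if } N=mn-2 \text{ with } n\ge 1,\\ 0, & \text{otherwise},\end{cases}$$ where $\xi_1=(-1)^{nm(m-1)/2}$ and $$R(m;t,n)=m[m]_t\left(\sum_{i=0}^{n}\binom{i+2}{2}t^{mi}+\sum_{i=n+1}^{2n}\binom{2n-i+2}{2}t^{mi}\right).$$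
   Context: The Narayana polynomials are $\gamma_n(t)=\sum_{k=0}^{n}\binom{n}{k}\binom{n-1}{k}\frac{1}{k+1}t^k$ (so $\gamma_0(t)=1$), with generating function $\gamma(t,q)=\sum_{n\ge0}\gamma_n(t)q^n$. Let $G(t,q)=(\gamma(t,q)-1)/q$. For $m\ge1$ the polynomials $\gamma^{(2m)}_n(t)$ are defined by $\sum_{n\ge0}\gamma^{(2m)}_n(t)q^n=G(t,q)^m$, and $\gamma^{(2m)}_i(t)=0$ for $i<0$. Equivalently, $\gamma^{(2m)}_{n-m}(t)$ is the coefficient of $q^n$ in $(\gamma(t,q)-1)^m$. The $q$-number is $[n]_x=1+x+\cdots+x^{n-1}$. *)

theory Defs
  imports "Jordan_Normal_Form.Determinant"
          "HOL-Computational_Algebra.Polynomial"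
          "HOL-Computational_Algebra.Formal_Power_Series"
begin

definition tt :: "rat poly" where "tt = [:0, 1:]"

definition narayana :: "nat \<Rightarrow> rat poly" where
  "narayana n = (if n = 0 then 1 else
     (\<Sum>k=0..n. smult (of_nat (n choose k) * of_nat ((n - 1) choose k) / of_nat (k + 1)) (tt ^ k)))"

definition narayana_fps :: "rat poly fps" where
  "narayana_fps = Abs_fps narayana"

definition gamma2m :: "nat \<Rightarrow> int \<Rightarrow> rat poly" where
  "gamma2m m k = (if k < 0 then 0 else fps_nth ((narayana_fps - 1) ^ m) (nat k + m))"

definition qnum :: "nat \<Rightarrow> rat poly \<Rightarrow> rat poly" where
  "qnum n x = (\<Sum>i<n. x ^ i)"

definition hankelH :: "nat \<Rightarrow> nat \<Rightarrow> rat poly" where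
  "hankelH m N = det (mat N N (\<lambda>(i, j). gamma2m m (int i + int j + 3 - int m)))"

definition Rpoly :: "nat \<Rightarrow> nat \<Rightarrow> rat poly" where
  "Rpoly m n = of_nat m * qnum m tt *
     ((\<Sum>i=0..n. of_nat ((i + 2) choose 2) * tt ^ (m * i))
      + (\<Sum>i=n+1..2*n. of_nat ((2 * n - i + 2) choose 2) * tt ^ (m * i)))"

definition xi1 :: "nat \<Rightarrow> nat \<Rightarrow> rat poly" where
  "xi1 m n = (-1) ^ (n * m * (m - 1) div 2)"

end

theory Submission
  imports Defs
begin

text \<open>
  Let \<open>g = \<gamma> - 1\<close>, so that \<open>g = q (1 + g) (1 + t g)\<close>, and put \<open>h = g^m\<close>, \<open>y = t^m\<close>, \<open>x = 1/q\<close>. Then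
  \<open>1/h + y h\<close> is a monic polynomial \<open>T\<close> of degree \<open>m\<close> in \<open>x\<close>. The polynomials \<open>P_n\<close> given by
  \<open>P_(n+1) = T P_n - y P_(n-1)\<close>, \<open>P_0 = 1\<close> satisfy \<open>P_n h = P_(n-1) + y^n h^(n+1)\<close>, which makes them
  orthogonal for the Hankel matrices \<open>A_N\<close> with entries \<open>[q^(i+j+1)] h\<close>. Hence \<open>A_(mn)\<close> becomes block
  triangular with anti-triangular blocks, and its determinant is known. The matrices of the theorem
  have entries \<open>[q^(i+j+3)] h\<close>; they are related to \<open>A_(mn)\<close> as follows.

  \<^item> \<open>N = mn\<close>: multiply \<open>A_N\<close> twice by the companion matrix of \<open>P_n\<close>.
  \<^item> \<open>N = mn - 1\<close>: delete the first row and column of \<open>A_(mn)\<close>, so Cramer's rule applies to the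
    explicit first column of the inverse, given by a Christoffel-Darboux kernel.
  \<^item> \<open>N = mn - 2\<close>: delete the first and last rows and columns of \<open>A_(mn)\<close>, so the first and
    last columns of the inverse suffice.
  \<^item> otherwise \<open>P_n\<close> with \<open>n = N div m\<close> is a kernel vector.

  The evaluations at \<open>x = 0\<close> take place at \<open>g = -1\<close>, where \<open>P_n\<close> is a signed \<open>q\<close>-number.
\<close>

subsection \<open>Determinants\<close>

text \<open>Laplace expansion along row \<open>i\<close> has one surviving term. Writing the minor
  through \<open>insert_index\<close> keeps it a matrix given by a function, so expansions can be
  chained.\<close>

lemma det_single_row_entry:
  fixes f :: "nat \<Rightarrow> nat \<Rightarrow> 'a :: comm_ring_1"
  assumes "i \<le> n" "j \<le> n" and "\<And>k. k \<le> n \<Longrightarrow> k \<noteq> j \<Longrightarrow> f i k = 0"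
  shows "det (mat (Suc n) (Suc n) (\<lambda>(a, b). f a b)) =
    (-1) ^ (i + j) * f i j * det (mat n n (\<lambda>(a, b). f (insert_index i a) (insert_index j b)))"
proof -
  let ?A = "mat (Suc n) (Suc n) (\<lambda>(a, b). f a b)"
  have "det ?A = (\<Sum>k<Suc n. ?A $$ (i, k) * cofactor ?A i k)"
    using assms by (intro laplace_expansion_row) auto
  also have "\<dots> = (\<Sum>k\<in>{j}. ?A $$ (i, k) * cofactor ?A i k)"
    using assms by (intro sum.mono_neutral_right) auto
  also have "mat_delete ?A i j = mat n n (\<lambda>(a, b). f (insert_index i a) (insert_index j b))"
    by (rule eq_matI) (auto simp: mat_delete_def insert_index_def)
  then have "(\<Sum>k\<in>{j}. ?A $$ (i, k) * cofactor ?A i k) =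
    (-1) ^ (i + j) * f i j * det (mat n n (\<lambda>(a, b). f (insert_index i a) (insert_index j b)))"
    using assms by (simp add: cofactor_def)
  finally show ?thesis .
qed

lemma det_single_col_entry:
  fixes f :: "nat \<Rightarrow> nat \<Rightarrow> 'a :: comm_ring_1"
  assumes "i \<le> n" "j \<le> n" and "\<And>k. k \<le> n \<Longrightarrow> k \<noteq> i \<Longrightarrow> f k j = 0"
  shows "det (mat (Suc n) (Suc n) (\<lambda>(a, b). f a b)) =
    (-1) ^ (i + j) * f i j * det (mat n n (\<lambda>(a, b). f (insert_index i a) (insert_index j b)))"
proof -
  have tr: "det (mat k k (\<lambda>(a, b). g a b)) = det (mat k k (\<lambda>(a, b). g b a))"
    for k and g :: "nat \<Rightarrow> nat \<Rightarrow> 'a"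
  proof -
    have "mat k k (\<lambda>(a, b). g b a) = transpose_mat (mat k k (\<lambda>(a, b). g a b))"
      by (rule eq_matI) auto
    then show ?thesis by (simp add: det_transpose[of _ k])
  qed
  show ?thesis
    using det_single_row_entry[of j n i "\<lambda>a b. f b a"] assms
    by (subst tr, subst (2) tr) (simp add: add.commute)
qed

text \<open>The first row has only its last entry, \<open>c\<close>; expanding along it leaves a
  matrix of the same shape. The signs multiply up to the sign of the reversal permutation.\<close>

lemma det_anti_triangular:
  fixes f :: "nat \<Rightarrow> nat \<Rightarrow> 'a :: comm_ring_1"
  assumes "\<And>i j. i + j + 1 < n \<Longrightarrow> f i j = 0" and "\<And>i j. i + j + 1 = n \<Longrightarrow> f i j = c"
  shows "det (mat n n (\<lambda>(i, j). f i j)) = (-1) ^ (n * (n - 1) div 2) * c ^ n"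
  using assms
proof (induction n arbitrary: f)
  case (Suc n)
  have IH: "det (mat n n (\<lambda>(i, j). f (Suc i) j)) = (-1) ^ (n * (n - 1) div 2) * c ^ n"
    using Suc.prems by (intro Suc.IH) auto
  have "mat n n (\<lambda>(i, j). f (insert_index 0 i) (insert_index n j)) = mat n n (\<lambda>(i, j). f (Suc i) j)"
    by (rule eq_matI) auto
  moreover have "Suc n * n div 2 = n + n * (n - 1) div 2"
    by (cases n) (auto simp: algebra_simps)
  ultimately show ?case
    using Suc.prems by (subst det_single_row_entry[of 0 n n]) (auto simp: IH power_add)
qed simp

lemma mat_times_mat:
  fixes f g :: "nat \<Rightarrow> nat \<Rightarrow> 'a :: semiring_0"
  shows "mat n k (\<lambda>(i, j). f i j) * mat k l (\<lambda>(i, j). g i j) = mat n l (\<lambda>(i, j). \<Sum>a<k. f i a * g a j)"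
  by (rule eq_matI) (auto simp: scalar_prod_def atLeast0LessThan)

lemma det_mat_times_mat:
  fixes f g :: "nat \<Rightarrow> nat \<Rightarrow> 'a :: comm_ring_1"
  shows "det (mat n n (\<lambda>(i, j). \<Sum>a<n. f i a * g a j)) =
    det (mat n n (\<lambda>(i, j). f i j)) * det (mat n n (\<lambda>(i, j). g i j))"
  by (subst mat_times_mat[symmetric], rule det_mult) auto

lemma det_mat_cong:
  assumes "\<And>i j. i < n \<Longrightarrow> j < n \<Longrightarrow> f i j = g i j"
  shows "det (mat n n (\<lambda>(i, j). f i j)) = det (mat n n (\<lambda>(i, j). g i j))"
  using assms by (intro arg_cong[where f = det] eq_matI) auto

lemma det_delta: "det (mat n n (\<lambda>(i, j). if i = j then 1 else 0)) = 1"
  using det_one[of n] by (simp add: one_mat_def)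

text \<open>Cramer's rule without division: multiply by the identity matrix with first column
  replaced by \<open>z\<close>. That factor has determinant \<open>z 0\<close>, and the product has
  first column \<open>(Y, 0, ..., 0)\<close>.\<close>

lemma cramer_first:
  fixes a :: "nat \<Rightarrow> nat \<Rightarrow> 'a :: comm_ring_1"
  assumes "\<And>i. i \<le> n \<Longrightarrow> (\<Sum>k\<le>n. a i k * z k) = (if i = 0 then Y else 0)"
  shows "det (mat (Suc n) (Suc n) (\<lambda>(i, j). a i j)) * z 0 =
    Y * det (mat n n (\<lambda>(i, j). a (Suc i) (Suc j)))"
proof -
  define E where "E = (\<lambda>i j. if j = 0 then z i else if i = j then 1 else 0 :: 'a)"
  define B where "B = (\<lambda>i j. \<Sum>k<Suc n. a i k * E k j)"
  have B0: "B i 0 = (if i = 0 then Y else 0)" if "i \<le> n" for i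
    using assms[OF that] by (simp add: B_def E_def lessThan_Suc_atMost)
  have BS: "B i j = a i j" if "j \<le> n" "j > 0" for i j
    using that by (auto simp: B_def E_def if_distrib [of "(*) _"] cong: if_cong)
  have "det (mat (Suc n) (Suc n) (\<lambda>(i, j). B i j)) = Y * det (mat n n (\<lambda>(i, j). B (Suc i) (Suc j)))"
    by (subst det_single_col_entry[of 0 n 0]) (auto simp: B0)
  also have "det (mat n n (\<lambda>(i, j). B (Suc i) (Suc j))) = det (mat n n (\<lambda>(i, j). a (Suc i) (Suc j)))"
    by (rule det_mat_cong) (simp add: BS)
  moreover have "det (mat (Suc n) (Suc n) (\<lambda>(i, j). E i j)) = z 0"
    using det_delta[of n, where ?'a = 'a]
    by (subst det_single_row_entry[of 0 n 0]) (auto simp: E_def)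
  ultimately show ?thesis
    unfolding B_def det_mat_times_mat by simp
qed

text \<open>The same idea with the first and last columns of the identity replaced by
  \<open>z\<close> and \<open>w\<close>. The determinant of that factor is the 2x2 minor of the
  corner entries, and \<open>w (Suc n) = 0\<close> leaves one of its two terms.\<close>

lemma cramer_first_last:
  fixes a :: "nat \<Rightarrow> nat \<Rightarrow> 'a :: comm_ring_1"
  assumes z: "\<And>i. i \<le> Suc n \<Longrightarrow> (\<Sum>k\<le>Suc n. a i k * z k) = (if i = 0 then Y else 0)"
    and w: "\<And>i. i \<le> Suc n \<Longrightarrow> (\<Sum>k\<le>Suc n. a i k * w k) = (if i = Suc n then Y' else 0)"
    and "w (Suc n) = 0"
  shows "det (mat (Suc (Suc n)) (Suc (Suc n)) (\<lambda>(i, j). a i j)) * - (z (Suc n) * w 0) =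
    Y * Y' * det (mat n n (\<lambda>(i, j). a (Suc i) (Suc j)))"
proof -
  let ?N = "Suc (Suc n)"
  define E where "E = (\<lambda>i j. if j = 0 then z i else if j = Suc n then w i
    else if i = j then 1 else 0 :: 'a)"
  define B where "B = (\<lambda>i j. \<Sum>k<?N. a i k * E k j)"
  have B0: "B i 0 = (if i = 0 then Y else 0)" if "i \<le> Suc n" for i
    using z[OF that] by (simp add: B_def E_def lessThan_Suc_atMost)
  have Bn: "B i (Suc n) = (if i = Suc n then Y' else 0)" if "i \<le> Suc n" for i
    using w[OF that] by (simp add: B_def E_def lessThan_Suc_atMost)
  have BS: "B i (Suc j) = a i (Suc j)" if "j < n" for i j
    using that by (auto simp: B_def E_def if_distrib [of "(*) _"] cong: if_cong)
  have "det (mat ?N ?N (\<lambda>(i, j). B i j)) = Y * det (mat (Suc n) (Suc n) (\<lambda>(i, j). B (Suc i) (Suc j)))"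
    by (subst det_single_col_entry[of 0 "Suc n" 0]) (auto simp: B0)
  also have "det (mat (Suc n) (Suc n) (\<lambda>(i, j). B (Suc i) (Suc j))) =
      Y' * det (mat n n (\<lambda>(i, j). B (Suc (insert_index n i)) (Suc (insert_index n j))))"
    by (subst det_single_col_entry[of n n n]) (auto simp: Bn)
  also have "det (mat n n (\<lambda>(i, j). B (Suc (insert_index n i)) (Suc (insert_index n j)))) =
      det (mat n n (\<lambda>(i, j). a (Suc i) (Suc j)))"
    by (rule det_mat_cong) (simp add: BS insert_index_def)
  moreover have "det (mat ?N ?N (\<lambda>(i, j). E i j)) = - (z (Suc n) * w 0)"
  proof -
    have "det (mat ?N ?N (\<lambda>(i, j). E i j)) =
      (-1) ^ Suc n * z (Suc n) * det (mat (Suc n) (Suc n) (\<lambda>(i, j). E (insert_index (Suc n) i) (Suc j)))"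
      using \<open>w (Suc n) = 0\<close> by (subst det_single_row_entry[of "Suc n" "Suc n" 0]) (auto simp: E_def)
    also have "det (mat (Suc n) (Suc n) (\<lambda>(i, j). E (insert_index (Suc n) i) (Suc j))) =
      (-1) ^ n * w 0 * det (mat n n (\<lambda>(i, j). E (insert_index (Suc n) (Suc i)) (Suc (insert_index n j))))"
      by (subst det_single_row_entry[of 0 n n]) (auto simp: E_def insert_index_def)
    also have "det (mat n n (\<lambda>(i, j). E (insert_index (Suc n) (Suc i)) (Suc (insert_index n j)))) = 1"
      by (subst det_delta[symmetric, of n], rule det_mat_cong) (auto simp: E_def insert_index_def)
    also have "(-1) ^ Suc n * z (Suc n) * ((-1) ^ n * w 0 * 1) = - (((-1) ^ n * (-1) ^ n) * (z (Suc n) * w 0))"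
      by (simp add: algebra_simps)
    also have "(-1) ^ n * (-1) ^ n = (1 :: 'a)" by (simp add: power_mult_distrib[symmetric])
    finally show ?thesis by simp
  qed
  ultimately show ?thesis
    unfolding B_def det_mat_times_mat by (simp add: algebra_simps)
qed

text \<open>The \<open>w k\<close> are the lower coefficients of a monic polynomial of degree
  \<open>N\<close> that annihilates the sequence. Right multiplication by its companion matrix
  \<open>E\<close> moves each column of the Hankel matrix to the next one.\<close>

lemma det_hankel_shift:
  fixes c :: "nat \<Rightarrow> 'a :: comm_ring_1"
  assumes "\<And>i. i < N \<Longrightarrow> (\<Sum>k<N. w k * c (i + k)) = - c (i + N)" and "N > 0"
  shows "det (mat N N (\<lambda>(i, j). c (i + j + 1))) = (-1) ^ N * w 0 * det (mat N N (\<lambda>(i, j). c (i + j)))"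
proof -
  obtain n where n: "N = Suc n" using \<open>N > 0\<close> by (cases N) auto
  define E where "E = (\<lambda>i j. if j = n then - w i else if i = Suc j then 1 else 0 :: 'a)"
  have "det (mat N N (\<lambda>(i, j). E i j)) = (-1) ^ n * - w 0 *
      det (mat n n (\<lambda>(i, j). E (Suc i) (insert_index n j)))"
    unfolding n by (subst det_single_row_entry[of 0 n n]) (auto simp: E_def)
  also have "det (mat n n (\<lambda>(i, j). E (Suc i) (insert_index n j))) = 1"
    by (subst det_delta[symmetric, of n], rule det_mat_cong) (auto simp: E_def insert_index_def)
  finally have E: "det (mat N N (\<lambda>(i, j). E i j)) = (-1) ^ N * w 0" by (simp add: n)
  have "det (mat N N (\<lambda>(i, j). c (i + j + 1))) = det (mat N N (\<lambda>(i, j). \<Sum>k<N. c (i + k) * E k j))"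
  proof (rule det_mat_cong)
    fix i j assume ij: "i < N" "j < N"
    show "c (i + j + 1) = (\<Sum>k<N. c (i + k) * E k j)"
    proof (cases "j = n")
      case True
      then show ?thesis
        using assms(1)[OF ij(1)] by (simp add: E_def sum_negf n mult.commute)
    next
      case False
      then have "(\<Sum>k<N. c (i + k) * E k j) = (\<Sum>k<N. if k = Suc j then c (i + k) else 0)"
        by (intro sum.cong) (auto simp: E_def)
      then show ?thesis using False ij by (simp add: n)
    qed
  qed
  then show ?thesis using det_mat_times_mat[of N "\<lambda>i k. c (i + k)" E] by (simp add: E mult.commute)
qed

subsection \<open>The functional equation of the Narayana series\<close>

lemma coeff_narayana:
  assumes "n > 0"
  shows "coeff (narayana n) k = of_nat (n choose k) * of_nat ((n - 1) choose k) / of_nat (k + 1)"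
proof -
  let ?a = "\<lambda>k. of_nat (n choose k) * of_nat ((n - 1) choose k) / of_nat (k + 1) :: rat"
  have tt: "coeff (tt ^ i) k = (if i = k then 1 else 0)" for i
    using monom_altdef[of "1 :: rat" i] by (simp add: tt_def flip: coeff_monom)
  have "coeff (narayana n) k = (\<Sum>i=0..n. ?a i * coeff (tt ^ i) k)"
    using assms by (simp add: narayana_def coeff_sum)
  also have "\<dots> = (\<Sum>i=0..n. if i = k then ?a i else 0)"
    by (intro sum.cong) (auto simp: tt)
  also have "\<dots> = ?a k"
    by auto
  finally show ?thesis .
qed

text \<open>The difference is taken in the field, not in the naturals, so no bound on
  \<open>k\<close> is required: for \<open>k > n\<close> both binomials vanish.\<close>

lemma of_nat_choose_Suc:
  "(of_nat (n choose Suc k) :: 'a :: field_char_0) =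
    (of_nat n - of_nat k) / (of_nat k + 1) * of_nat (n choose k)"
proof (cases "k \<le> n")
  case True
  have "Suc k * (n choose Suc k) = (n - k) * (n choose k)"
    using binomial_absorb_comp[of n k] binomial_absorption[of k n] by simp
  then have "of_nat (Suc k) * of_nat (n choose Suc k) = (of_nat n - of_nat k) * (of_nat (n choose k) :: 'a)"
    using True by (metis of_nat_diff of_nat_mult)
  moreover have "of_nat k + 1 \<noteq> (0 :: 'a)" by (metis of_nat_Suc of_nat_neq_0 add.commute)
  ultimately show ?thesis by (simp add: field_simps)
qed (simp add: binomial_eq_0)

text \<open>The coefficient of \<open>t^(l + 3)\<close> in the three-term recurrence, divided by \<open>(j choose l)\<^sup>2\<close>;
  \<open>b1\<close>, \<open>b2\<close>, \<open>b3\<close> are the ratios of the next three binomial coefficients to \<open>j choose l\<close>.\<close>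

lemma narayana_recurrence_identity:
  fixes J L :: rat
  assumes "L \<ge> 0" and b: "b1 = (J - L) / (L + 1)" "b2 = (J - L - 1) / (L + 2) * b1"
    "b3 = (J - L - 2) / (L + 3) * b2"
  shows "(J + 4) * ((b3 + 3 * b2 + 3 * b1 + 1) * (b3 + 2 * b2 + b1) / (L + 4)) =
    (2 * J + 5) * ((b3 + 2 * b2 + b1) * (b3 + b2) / (L + 4)
      + (b2 + 2 * b1 + 1) * (b2 + b1) / (L + 3))
    - (J + 1) * ((b3 + b2) * b3 / (L + 4) - 2 * ((b2 + b1) * b2 / (L + 3)) + (b1 + 1) * b1 / (L + 2))"
proof -
  have "L + 1 \<noteq> 0" "L + 2 \<noteq> 0" "L + 3 \<noteq> 0" "L + 4 \<noteq> 0" using \<open>L \<ge> 0\<close> by auto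
  then show ?thesis
    unfolding b by (simp add: divide_simps) (simp add: algebra_simps)
qed

text \<open>Read on generating functions, this recurrence is a first-order linear differential
  equation, which is how the closed form leads to the functional equation.\<close>

lemma narayana_recurrence:
  "of_nat (j + 4) * narayana (j + 3) =
    of_nat (2 * j + 5) * (1 + tt) * narayana (j + 2) - of_nat (j + 1) * (1 - tt)\<^sup>2 * narayana (j + 1)"
proof (rule poly_eqI)
  fix k
  have tt: "tt * p = pCons 0 p" for p by (simp add: tt_def)
  have ofn: "of_nat a * p = smult (of_nat a) p" for a and p :: "rat poly"
    by (simp add: of_nat_poly)
  let ?c = "\<lambda>n k. of_nat (n choose k) :: rat" and ?J = "of_nat j :: rat"
  define a b c A2 A1 A0 where "a = coeff (narayana (j + 3)) k" "b = coeff (narayana (j + 2)) k"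
    "c = coeff (narayana (j + 1)) k" "A2 = coeff (tt * narayana (j + 2)) k"
    "A1 = coeff (tt * narayana (j + 1)) k" "A0 = coeff (tt * (tt * narayana (j + 1))) k"
  note defs = this
  have *: "of_nat (j + 4) * a = of_nat (2 * j + 5) * (b + A2) - of_nat (j + 1) * (c - 2 * A1 + A0)"
  proof -
    \<comment> \<open>The recurrence reaches back to coefficients \<open>k - 1\<close> and
      \<open>k - 2\<close>, and the generic case takes \<open>l = k - 3\<close> as base index; the
      values below 3 are checked by hand.\<close>
    have "k = 0 \<or> k = 1 \<or> k = 2 \<or> k = (k - 3) + 3" by arith
    then consider "k = 0" | "k = 1" | "k = 2" | l where "k = l + 3" by blast
    then show ?thesis
    proof cases
      case 1
      then show ?thesis by (simp add: defs tt coeff_narayana)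
    next
      case 2
      have e: "a = (?J + 3) * (?J + 2) / 2" "b = (?J + 2) * (?J + 1) / 2" "c = (?J + 1) * ?J / 2"
        "A2 = 1" "A1 = 1" "A0 = 0"
        by (simp_all add: defs tt coeff_narayana 2) (simp_all add: algebra_simps)
      show ?thesis unfolding e by (simp add: field_simps)
    next
      case 3
      have c2: "?c n 2 = of_nat n * (of_nat n - 1) / 2" for n
        using of_nat_choose_Suc[of n 1, where ?'a = rat] by (simp add: numeral_2_eq_2)
      have e: "a = (?J + 3) * (?J + 2) * ((?J + 2) * (?J + 1)) / 12"
        "b = (?J + 2) * (?J + 1) * ((?J + 1) * ?J) / 12"
        "c = (?J + 1) * ?J * (?J * (?J - 1)) / 12"
        by (simp_all add: defs coeff_narayana 3 c2) (simp_all add: algebra_simps)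
      have e': "A2 = (?J + 2) * (?J + 1) / 2" "A1 = (?J + 1) * ?J / 2" "A0 = 1"
        by (simp_all add: defs tt coeff_narayana 3 numeral_2_eq_2) (simp_all add: algebra_simps)
      show ?thesis unfolding e e' by (simp add: field_simps)
    next
      case (4 l)
      \<comment> \<open>Pascal's rule makes every binomial that occurs a multiple of
        \<open>B\<close>. The rational identity is then multiplied by \<open>B\<close> squared, so
        \<open>B = 0\<close> needs no separate treatment.\<close>
      define B where "B = ?c j l"
      define b1 b2 b3 where b: "b1 = (of_nat j - of_nat l) / (of_nat l + 1 :: rat)"
        "b2 = (of_nat j - of_nat l - 1) / (of_nat l + 2) * b1"
        "b3 = (of_nat j - of_nat l - 2) / (of_nat l + 3) * b2"
      have c1: "?c j (Suc l) = b1 * B"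
        by (simp add: of_nat_choose_Suc b B_def)
      have c2: "?c j (Suc (Suc l)) = b2 * B"
        by (subst of_nat_choose_Suc, subst c1) (simp add: b(2) diff_diff_add add.commute)
      have c3: "?c j (Suc (Suc (Suc l))) = b3 * B"
        by (subst of_nat_choose_Suc, subst c2) (simp add: b(3) diff_diff_add add.commute)
      note c = B_def[symmetric] c1 c2 c3
      have d1: "?c (Suc j) (Suc l) = (b1 + 1) * B" "?c (Suc j) (Suc (Suc l)) = (b2 + b1) * B"
         "?c (Suc j) (Suc (Suc (Suc l))) = (b3 + b2) * B" by (simp_all add: c algebra_simps)
      have d2: "?c (Suc (Suc j)) (Suc (Suc l)) = (b2 + 2 * b1 + 1) * B"
         "?c (Suc (Suc j)) (Suc (Suc (Suc l))) = (b3 + 2 * b2 + b1) * B"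
        unfolding binomial_Suc_Suc[of "Suc j"] of_nat_add d1 by (simp_all add: algebra_simps)
      have d3: "?c (Suc (Suc (Suc j))) (Suc (Suc (Suc l))) = (b3 + 3 * b2 + 3 * b1 + 1) * B"
        unfolding binomial_Suc_Suc[of "Suc (Suc j)"] of_nat_add d2 by (simp add: algebra_simps)
      have k: "k = Suc (Suc (Suc l))" "k - 1 = Suc (Suc l)" "k - 2 = Suc l" using 4 by auto
      have nn: "j + 3 = Suc (Suc (Suc j))" "j + 2 = Suc (Suc j)" "j + 1 = Suc j" by auto
      have "coeff (narayana (j + 3)) k = B\<^sup>2 * ((b3 + 3 * b2 + 3 * b1 + 1) * (b3 + 2 * b2 + b1) / (of_nat l + 4))"
        "coeff (narayana (j + 2)) k = B\<^sup>2 * ((b3 + 2 * b2 + b1) * (b3 + b2) / (of_nat l + 4))"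
        "coeff (narayana (j + 1)) k = B\<^sup>2 * ((b3 + b2) * b3 / (of_nat l + 4))"
        unfolding nn k
        by (simp_all add: coeff_narayana d3 d2 d1 c1 c2 c3 del: binomial_Suc_Suc) (simp_all add: power2_eq_square algebra_simps)
      moreover have
        "coeff (tt * narayana (j + 2)) k = B\<^sup>2 * ((b2 + 2 * b1 + 1) * (b2 + b1) / (of_nat l + 3))"
        "coeff (tt * narayana (j + 1)) k = B\<^sup>2 * ((b2 + b1) * b2 / (of_nat l + 3))"
        "coeff (tt * (tt * narayana (j + 1))) k = B\<^sup>2 * ((b1 + 1) * b1 / (of_nat l + 2))"
        unfolding nn k
        by (simp_all add: tt coeff_narayana d3 d2 d1 c1 c2 c3 del: binomial_Suc_Suc) (simp_all add: power2_eq_square algebra_simps)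
      ultimately show ?thesis
        using arg_cong[OF narayana_recurrence_identity[OF _ b, simplified], of "(*) (B\<^sup>2)"]
        by (simp add: defs) (simp add: algebra_simps)
    qed
  qed
  have "of_nat (2 * j + 5) * (1 + tt) * narayana (j + 2) - of_nat (j + 1) * (1 - tt)\<^sup>2 * narayana (j + 1)
    = of_nat (2 * j + 5) * (narayana (j + 2) + tt * narayana (j + 2))
      - of_nat (j + 1) * (narayana (j + 1) - of_nat 2 * (tt * narayana (j + 1)) + tt * (tt * narayana (j + 1)))"
    by (simp add: power2_eq_square algebra_simps)
  then show "coeff (of_nat (j + 4) * narayana (j + 3)) k = coeff (of_nat (2 * j + 5) * (1 + tt) * narayana (j + 2)
     - of_nat (j + 1) * (1 - tt)\<^sup>2 * narayana (j + 1)) k"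
    using * by (simp only: ofn coeff_smult coeff_add coeff_diff defs) simp
qed

text \<open>If all coefficients of \<open>D\<close> up to index \<open>k\<close> vanish, coefficient
  \<open>k\<close> of the equation reduces to \<open>k + 1\<close> times coefficient
  \<open>k + 1\<close> of \<open>D\<close>.\<close>

lemma fps_first_order_ode_unique:
  fixes D S U :: "'a :: {idom, ring_char_0} fps"
  assumes "fps_nth S 0 = 1" and ode: "S * fps_deriv D = U * D" and "fps_nth D 0 = 0"
  shows "D = 0"
proof -
  have "fps_nth D n = 0" for n
  proof (induction n rule: less_induct)
    case (less n)
    show ?case
    proof (cases n)
      case (Suc k)
      have "fps_nth (S * fps_deriv D) k = (\<Sum>i\<in>{0}. fps_nth S i * fps_nth (fps_deriv D) (k - i))"
        unfolding fps_mult_nth using less Suc by (intro sum.mono_neutral_right) auto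
      moreover have "fps_nth (U * D) k = 0"
        unfolding fps_mult_nth using less Suc by (intro sum.neutral) auto
      ultimately have "of_nat (Suc k) * fps_nth D (Suc k) = 0"
        using ode assms(1) by simp
      then show ?thesis using Suc by (simp del: of_nat_Suc)
    qed (use assms in simp)
  qed
  then show ?thesis by (simp add: fps_eq_iff)
qed

definition nar_g :: "rat poly fps" where
  "nar_g = narayana_fps - 1"

text \<open>\<open>S\<close> is the discriminant of the quadratic equation for \<open>g\<close>, and
  \<open>w\<close> is what its square root should be. The recurrence gives 2 S w' = S' w, so w^2 and
  S solve the same linear equation with the same initial value. Hence w^2 = S, which is the
  quadratic equation times -4 t q.\<close>

lemma nar_g_functional_equation:
  "nar_g = fps_X * (1 + nar_g) * (1 + fps_const tt * nar_g)"
proof -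
  define g where "g = nar_g"
  define t where "t = fps_const tt"
  define a b where "a = 1 + tt" and "b = (1 - tt)\<^sup>2"
  define S where "S = 1 - fps_const (2 * a) * fps_X + fps_const b * fps_X\<^sup>2"
  define w where "w = 1 - fps_const a * fps_X - fps_const (2 * tt) * (fps_X * g)"
  have w0: "fps_nth w 0 = 1" and w1: "fps_nth w (Suc 0) = - a"
    and w2: "fps_nth w (Suc (Suc n)) = - 2 * tt * narayana (Suc n)" for n
    by (simp_all add: w_def g_def nar_g_def narayana_fps_def narayana_def)
  have Sw: "S * fps_deriv w = fps_deriv w - fps_const (2 * a) * (fps_X * fps_deriv w)
      + fps_const b * (fps_X * (fps_X * fps_deriv w))"
    by (simp add: S_def power2_eq_square algebra_simps)
  have dS: "fps_deriv S * w = fps_const 2 * (fps_const b * (fps_X * w) - fps_const a * w)"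
    by (simp add: S_def power2_eq_square algebra_simps fps_const_mult[symmetric] del: fps_const_mult) (simp add: numeral_fps_const)
  \<comment> \<open>Coefficients from index 3 on are the Narayana recurrence; the first three
    involve the initial coefficients of \<open>w\<close> and are computed.\<close>
  have "fps_const 2 * (S * fps_deriv w) = fps_deriv S * w"
  proof (rule fps_ext)
    fix n
    consider "n = 0" | "n = 1" | "n = 2" | j where "n = Suc (Suc (Suc j))"
      by (metis One_nat_def not0_implies_Suc numeral_2_eq_2)
    then have "fps_nth (S * fps_deriv w) n = fps_nth (fps_const b * (fps_X * w) - fps_const a * w) n"
    proof cases
      case (4 j)
      let ?N = "\<lambda>i. narayana (Suc i)" and ?J = "of_nat j :: rat poly"
      have rec: "(?J + 4) * ?N (Suc (Suc j)) = (2 * ?J + 5) * a * ?N (Suc j) - (?J + 1) * b * ?N j"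
        using narayana_recurrence[of j] by (simp add: numeral_3_eq_3 a_def b_def add.commute)
      have "fps_nth (S * fps_deriv w) n - fps_nth (fps_const b * (fps_X * w) - fps_const a * w) n =
        - 2 * tt * ((?J + 4) * ?N (Suc (Suc j)) - ((2 * ?J + 5) * a * ?N (Suc j) - (?J + 1) * b * ?N j))"
        by (simp add: 4 Sw w2 algebra_simps)
      then show ?thesis by (simp add: rec)
    next
      case 3
      have "narayana (Suc 0) = 1" "narayana (Suc (Suc 0)) = a"
        by (simp_all add: narayana_def a_def)
      then show ?thesis
        by (simp add: 3 Sw w0 w1 w2 numeral_2_eq_2)
    qed (simp_all add: Sw w0 w1 w2 narayana_def a_def b_def power2_eq_square algebra_simps)
    then show "fps_nth (fps_const 2 * (S * fps_deriv w)) n = fps_nth (fps_deriv S * w) n"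
      by (simp add: dS)
  qed
  then have "2 * S * fps_deriv w = fps_deriv S * w" by (simp add: numeral_fps_const mult.assoc)
  then have "S * fps_deriv (w\<^sup>2) = fps_deriv S * w\<^sup>2"
    by (simp add: power2_eq_square algebra_simps)
  then have "S * fps_deriv (w\<^sup>2 - S) = fps_deriv S * (w\<^sup>2 - S)"
    by (simp add: algebra_simps)
  moreover have "fps_nth S 0 = 1" "fps_nth (w\<^sup>2 - S) 0 = 0"
    using w0 by (simp_all add: S_def power2_eq_square)
  ultimately have S: "w\<^sup>2 - S = 0"
    by (intro fps_first_order_ode_unique)
  have c: "fps_const a = 1 + t" "fps_const (2 * a) = 2 * (1 + t)" "fps_const (2 * tt) = 2 * t"
      "fps_const b = (1 - t)\<^sup>2"
    unfolding a_def b_def t_def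
    by (simp_all add: numeral_fps_const fps_const_power flip: fps_const_1_eq_1)
  have "w\<^sup>2 - S = - 4 * t * fps_X * (g - fps_X * (1 + g) * (1 + t * g))"
    unfolding w_def S_def c by (simp add: power2_eq_square algebra_simps)
  then have "- 4 * t * fps_X * (g - fps_X * (1 + g) * (1 + t * g)) = 0"
    by (rule trans[OF sym S])
  moreover have "- 4 * t * fps_X \<noteq> 0" by (simp add: t_def tt_def)
  ultimately have "g - fps_X * (1 + g) * (1 + t * g) = 0"
    using no_zero_divisors by blast
  then show ?thesis unfolding t_def g_def by (rule iffD1[OF right_minus_eq])
qed

subsection \<open>Polynomials in the inverse variable\<close>

text \<open>A polynomial \<open>p\<close> in \<open>x = 1/q\<close> acts on power series in \<open>q\<close>: multiply by \<open>p\<close> and drop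
  the negative powers of \<open>q\<close>. Coefficient \<open>i\<close> of the result is row \<open>i\<close> of the infinite Hankel
  matrix of \<open>F\<close> times the coefficient vector of \<open>p\<close>.\<close>

definition shift_act :: "'a :: comm_ring_1 poly \<Rightarrow> 'a fps \<Rightarrow> 'a fps" where
  "shift_act p F = Abs_fps (\<lambda>i. \<Sum>j\<le>degree p. coeff p j * fps_nth F (i + j))"

lemma shift_act_nth:
  assumes "degree p \<le> d"
  shows "fps_nth (shift_act p F) i = (\<Sum>j\<le>d. coeff p j * fps_nth F (i + j))"
  unfolding shift_act_def fps_nth_Abs_fps
  using assms by (intro sum.mono_neutral_left) (auto simp: coeff_eq_0)

lemma shift_act_nth_less:
  assumes "degree p < d"
  shows "fps_nth (shift_act p F) i = (\<Sum>j<d. coeff p j * fps_nth F (i + j))"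
  using assms shift_act_nth[of p "d - 1" F i] by (cases d) (auto simp: lessThan_Suc_atMost)

lemma shift_act_0 [simp]: "shift_act 0 F = 0"
  by (rule fps_ext) (simp add: shift_act_def)

lemma shift_act_pCons: "shift_act (pCons a p) F = fps_const a * F + fps_shift 1 (shift_act p F)"
proof (rule fps_ext)
  fix i
  have "degree (pCons a p) \<le> Suc (degree p)" by (rule degree_pCons_le)
  then have "fps_nth (shift_act (pCons a p) F) i =
      (\<Sum>j\<le>Suc (degree p). coeff (pCons a p) j * fps_nth F (i + j))"
    by (rule shift_act_nth)
  also have "\<dots> = a * fps_nth F i + (\<Sum>j\<le>degree p. coeff p j * fps_nth F (i + 1 + j))"
    by (subst sum.atMost_Suc_shift) simp
  finally show "fps_nth (shift_act (pCons a p) F) i =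
      fps_nth (fps_const a * F + fps_shift 1 (shift_act p F)) i"
    by (simp add: shift_act_def)
qed

lemma shift_act_1 [simp]: "shift_act 1 F = F"
  by (simp add: one_pCons shift_act_pCons)

lemma shift_act_add: "shift_act (p + q) F = shift_act p F + shift_act q F"
proof (rule fps_ext)
  fix i
  let ?d = "max (degree p) (degree q)"
  have "degree (p + q) \<le> ?d" by (rule degree_add_le_max)
  then show "fps_nth (shift_act (p + q) F) i = fps_nth (shift_act p F + shift_act q F) i"
    by (simp add: shift_act_nth[of _ ?d] sum.distrib algebra_simps)
qed

lemma shift_act_smult: "shift_act (smult c p) F = fps_const c * shift_act p F"
  by (rule fps_ext)
    (simp add: shift_act_nth[where d = "degree p"] degree_smult_le sum_distrib_left mult.assoc)

lemma shift_act_diff: "shift_act (p - q) F = shift_act p F - shift_act q F"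
  using shift_act_add[of p "smult (- 1) q" F]
  by (simp only: shift_act_smult) (simp flip: fps_const_neg)

lemma shift_act_right_add: "shift_act p (F + G) = shift_act p F + shift_act p G"
  by (rule fps_ext) (simp add: shift_act_def sum.distrib algebra_simps)

lemma shift_act_right_const_mult: "shift_act p (fps_const c * F) = fps_const c * shift_act p F"
  by (rule fps_ext) (simp add: shift_act_def sum_distrib_left algebra_simps)

text \<open>On a constant every positive power of x yields only negative powers of q, so just the
  value of \<open>p\<close> at x = 0 survives. This is where evaluations at x = 0 enter.\<close>

lemma shift_act_fps_const: "shift_act p (fps_const c) = fps_const (coeff p 0 * c)"
proof (rule fps_ext)
  fix i
  have "fps_nth (shift_act p (fps_const c)) i = (\<Sum>j\<in>{0}. coeff p j * fps_nth (fps_const c) (i + j))"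
    unfolding shift_act_def fps_nth_Abs_fps by (intro sum.mono_neutral_right) auto
  then show "fps_nth (shift_act p (fps_const c)) i = fps_nth (fps_const (coeff p 0 * c)) i"
    by simp
qed

text \<open>Negative powers of q stay negative under multiplication by x, so dropping them early or
  late makes no difference.\<close>

lemma shift_act_mult: "shift_act (p * q) F = shift_act p (shift_act q F)"
  by (induction p) (simp_all add: shift_act_pCons shift_act_add shift_act_smult)

lemma shift_act_monom_mult_nth:
  "fps_nth (shift_act (monom 1 r * p) F) i = fps_nth (shift_act p F) (i + r)"
proof -
  have "shift_act (monom 1 r * p) F = fps_shift r (shift_act p F)"
    by (induction r) (simp_all add: monom_Suc shift_act_pCons fps_shift_fps_shift[symmetric])
  then show ?thesis by simp
qed

section \<open>Dickson polynomials and their action on power series\<close>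

text \<open>Dickson (rescaled Chebyshev) polynomials of the first and second kind, composed with \<open>a\<close>:
  for \<open>a = 1/u + c u\<close> they are \<open>1/u^n + (c u)^n\<close> and \<open>(1/u^(n+1) - (c u)^(n+1)) / (1/u - c u)\<close>.\<close>

fun dickson1 :: "'a :: comm_ring_1 poly \<Rightarrow> 'a \<Rightarrow> nat \<Rightarrow> 'a poly" where
  "dickson1 a c 0 = 2"
| "dickson1 a c (Suc 0) = a"
| "dickson1 a c (Suc (Suc n)) = a * dickson1 a c (Suc n) - smult c (dickson1 a c n)"

fun dickson2 :: "'a :: comm_ring_1 poly \<Rightarrow> 'a \<Rightarrow> nat \<Rightarrow> 'a poly" where
  "dickson2 a c 0 = 1"
| "dickson2 a c (Suc 0) = a"
| "dickson2 a c (Suc (Suc n)) = a * dickson2 a c (Suc n) - smult c (dickson2 a c n)"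

lemma monic_mult_minus_smult:
  fixes a p q :: "'a :: idom poly"
  assumes "degree a = d" "lead_coeff a = 1" "d > 0" "degree p = e" "lead_coeff p = 1" "degree q < e + d"
  shows "degree (a * p - smult c q) = d + e \<and> lead_coeff (a * p - smult c q) = 1"
proof -
  have "a \<noteq> 0" "p \<noteq> 0" using assms by auto
  then have deg: "degree (a * p) = d + e" using assms by (simp add: degree_mult_eq)
  have lc: "lead_coeff (a * p) = 1" using assms by (simp only: lead_coeff_mult)  simp
  have "degree (smult c q) < d + e"
    using assms degree_smult_le[of c q] by linarith
  then have "degree (a * p - smult c q) = d + e" "coeff (smult c q) (d + e) = 0"
    using deg degree_add_eq_left[of "- smult c q" "a * p"] coeff_eq_0[of "smult c q"] by simp_all
  then show ?thesis using lc deg by simp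
qed

lemma monic_dickson1:
  fixes a :: "'a :: idom poly"
  assumes "degree a = d" "lead_coeff a = 1" "d > 0"
  shows "degree (dickson1 a c (Suc n)) = d * Suc n \<and> lead_coeff (dickson1 a c (Suc n)) = 1"
proof (induction n rule: less_induct)
  case (less n)
  show ?case
  proof (cases n)
    case (Suc k)
    have "degree (dickson1 a c k) < d * Suc k + d"
      using less[of "k - 1"] Suc assms by (cases k) auto
    moreover have "degree (dickson1 a c (Suc k)) = d * Suc k" "lead_coeff (dickson1 a c (Suc k)) = 1"
      using less[of k] Suc by blast+
    ultimately show ?thesis
      unfolding Suc dickson1.simps mult_Suc_right[of d "Suc k"]
      by (intro monic_mult_minus_smult[OF assms])
  qed (use assms in simp)
qed

lemma monic_dickson2:
  fixes a :: "'a :: idom poly"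
  assumes "degree a = d" "lead_coeff a = 1" "d > 0"
  shows "degree (dickson2 a c n) = d * n \<and> lead_coeff (dickson2 a c n) = 1"
proof (induction n rule: less_induct)
  case (less n)
  consider "n = 0" | "n = 1" | k where "n = Suc (Suc k)"
    by (metis One_nat_def not0_implies_Suc)
  then show ?case
  proof cases
    case (3 k)
    have "degree (dickson2 a c k) < d * Suc k + d"
      using less[of k] 3 assms by auto
    moreover have "degree (dickson2 a c (Suc k)) = d * Suc k" "lead_coeff (dickson2 a c (Suc k)) = 1"
      using less[of "Suc k"] 3 by blast+
    ultimately show ?thesis
      unfolding 3 dickson2.simps mult_Suc_right[of d "Suc k"]
      by (intro monic_mult_minus_smult[OF assms])
  qed (use assms in simp_all)
qed

text \<open>By hypothesis \<open>a\<close> acts on positive powers of \<open>f\<close> as 1/f + c f,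
  so \<open>dickson1 a c k\<close> acts as 1/f^k + (c f)^k. Applying it to
  \<open>f ^ (i + k)\<close> keeps all exponents nonnegative.\<close>

lemma shift_act_dickson1:
  fixes f :: "'a :: comm_ring_1 fps"
  assumes act: "\<And>i. shift_act a (f ^ Suc i) = f ^ i + fps_const c * f ^ Suc (Suc i)"
  shows "shift_act (dickson1 a c k) (f ^ (i + k)) = f ^ i + fps_const (c ^ k) * f ^ (i + 2 * k)"
proof (induction k arbitrary: i rule: less_induct)
  case (less k)
  consider "k = 0" | "k = 1" | l where "k = Suc (Suc l)"
    by (metis One_nat_def not0_implies_Suc)
  then show ?case
  proof cases
    case 1
    have "shift_act (dickson1 a c 0) (f ^ i) = fps_const 2 * f ^ i"
      using shift_act_smult[of 2 1 "f ^ i"] by (simp add: numeral_poly)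
    then show ?thesis by (simp add: 1 algebra_simps flip: numeral_fps_const)
  next
    case 2
    then show ?thesis using act[of i] by simp
  next
    case (3 l)
    \<comment> \<open>The two induction hypotheses are taken at \<open>Suc i\<close> and
      \<open>Suc (Suc i)\<close>, so that both concern the same power
      \<open>f ^ (i + k)\<close>.\<close>
    have IH1: "shift_act (dickson1 a c (Suc l)) (f ^ (i + k)) =
        f ^ Suc i + fps_const (c ^ Suc l) * f ^ Suc (i + 2 * Suc l)"
      using less[of "Suc l" "Suc i"] 3 by (simp only: add_Suc add_Suc_right)
    have IH2: "shift_act (dickson1 a c l) (f ^ (i + k)) =
        f ^ Suc (Suc i) + fps_const (c ^ l) * f ^ (i + 2 * Suc l)"
      using less[of l "Suc (Suc i)"] 3 by (simp del: power_Suc)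
    have c: "fps_const (c ^ Suc l) = fps_const c * fps_const (c ^ l)"
      "fps_const (c ^ k) = fps_const c * (fps_const c * fps_const (c ^ l))"
      by (simp_all add: 3)
    have "shift_act (dickson1 a c k) (f ^ (i + k)) =
        f ^ i + fps_const c * f ^ Suc (Suc i)
        + fps_const (c ^ Suc l) * (f ^ (i + 2 * Suc l) + fps_const c * f ^ Suc (Suc (i + 2 * Suc l)))
        - fps_const c * (f ^ Suc (Suc i) + fps_const (c ^ l) * f ^ (i + 2 * Suc l))"
      unfolding 3 dickson1.simps shift_act_diff shift_act_mult shift_act_smult
        IH1[unfolded 3] IH2[unfolded 3] shift_act_right_add shift_act_right_const_mult act ..
    also have "Suc (Suc (i + 2 * Suc l)) = i + 2 * k" by (simp add: 3)
    finally show ?thesis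
      unfolding c by (simp add: algebra_simps del: fps_const_mult)
  qed
qed

text \<open>The powers of \<open>h\<close> cancel in the recurrence except for the top one. The
  constants left over are multiplied only by the value of \<open>a\<close> at x = 0, and so follow
  the recurrence of \<open>V\<close>.\<close>

lemma shift_act_dickson2:
  fixes h :: "'a :: comm_ring_1 fps"
  assumes act: "\<And>i. shift_act a (h ^ Suc i) = h ^ i + fps_const y * h ^ Suc (Suc i)"
    and V: "V 0 = 0" "V 1 = 1" "\<And>n. V (Suc (Suc n)) = coeff a 0 * V (Suc n) - y * V n"
  shows "shift_act (dickson2 a y n) h = fps_const (V n) + fps_const (y ^ n) * h ^ Suc n"
proof (induction n rule: less_induct)
  case (less n)
  consider "n = 0" | "n = 1" | k where "n = Suc (Suc k)"
    by (metis One_nat_def not0_implies_Suc)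
  then show ?case
  proof cases
    case 2
    then show ?thesis using act[of 0] V by simp
  next
    case (3 k)
    have IH: "shift_act (dickson2 a y (Suc k)) h = fps_const (V (Suc k)) + fps_const (y ^ Suc k) * h ^ Suc (Suc k)"
      "shift_act (dickson2 a y k) h = fps_const (V k) + fps_const (y ^ k) * h ^ Suc k"
      by (rule less, simp add: 3)+
    have c: "fps_const (y ^ Suc k) = fps_const y * fps_const (y ^ k)"
      "fps_const (y ^ n) = fps_const y * (fps_const y * fps_const (y ^ k))"
      "fps_const (V n) = fps_const (coeff a 0 * V (Suc k)) - fps_const y * fps_const (V k)"
      by (simp_all add: 3 V)
    have "shift_act (dickson2 a y n) h = fps_const (coeff a 0 * V (Suc k)) +
        fps_const (y ^ Suc k) * (h ^ Suc k + fps_const y * h ^ Suc (Suc (Suc k)))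
        - fps_const y * (fps_const (V k) + fps_const (y ^ k) * h ^ Suc k)"
      unfolding 3 dickson2.simps shift_act_diff shift_act_mult shift_act_smult IH
        shift_act_right_add shift_act_right_const_mult shift_act_fps_const act ..
    then show ?thesis
      unfolding c unfolding 3 by (simp add: algebra_simps del: fps_const_mult fps_const_sub)
  qed (use V in simp)
qed

subsection \<open>The orthogonal polynomials of the power of the Narayana series\<close>

text \<open>By the functional equation g = q u with u(0) = 1, so g^j begins with q^j.\<close>

lemma nar_g_power_nth: "k < j \<Longrightarrow> fps_nth (nar_g ^ j) k = 0" "fps_nth (nar_g ^ j) j = 1"
proof -
  define u where "u = (1 + nar_g) * (1 + fps_const tt * nar_g)"
  have "nar_g = fps_X * u"
    using nar_g_functional_equation unfolding u_def mult.assoc .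
  then have g: "nar_g ^ j = fps_X ^ j * u ^ j"
    by (metis power_mult_distrib)
  have "fps_nth nar_g 0 = 0" by (simp add: nar_g_def narayana_fps_def narayana_def)
  then have "fps_nth u 0 = 1" by (simp add: u_def)
  then show "k < j \<Longrightarrow> fps_nth (nar_g ^ j) k = 0" "fps_nth (nar_g ^ j) j = 1"
    unfolding g fps_X_power_mult_nth by (simp_all add: fps_nth_power_0)
qed

text \<open>With \<open>x = 1/q\<close> the functional equation reads \<open>x - (1 + t) = 1/g + t g\<close>, so \<open>chebT m\<close> is
  \<open>1/h + y h\<close> for \<open>h = g^m\<close>, \<open>y = t^m\<close>, written as a polynomial in \<open>x\<close>. The number \<open>chebV m n\<close>
  is the value of \<open>chebP m (n - 1)\<close> at \<open>x = 0\<close>, that is, at \<open>g = -1\<close>.\<close>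

definition chebT :: "nat \<Rightarrow> rat poly poly" where
  "chebT m = dickson1 [:- (1 + tt), 1:] tt m"

definition chebP :: "nat \<Rightarrow> nat \<Rightarrow> rat poly poly" where
  "chebP m n = dickson2 (chebT m) (tt ^ m) n"

definition chebV :: "nat \<Rightarrow> nat \<Rightarrow> rat poly" where
  "chebV m n = (- 1) ^ (m * (n + 1)) * qnum n (tt ^ m)"

text \<open>This is the functional equation multiplied by g^i and divided by q; the shift is an
  exact division because the right-hand side carries the factor q.\<close>

lemma shift_act_nar_g:
  "shift_act [:- (1 + tt), 1:] (nar_g ^ Suc i) = nar_g ^ i + fps_const tt * nar_g ^ Suc (Suc i)"
proof -
  have c: "fps_const (- (1 + tt)) = - (1 + fps_const tt)"
    by (simp only: fps_const_neg[symmetric] fps_const_add[symmetric] fps_const_1_eq_1)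
  have "nar_g ^ Suc i = fps_X * (1 + nar_g) * (1 + fps_const tt * nar_g) * nar_g ^ i"
    unfolding power_Suc
    by (rule arg_cong[where f = "\<lambda>x. x * nar_g ^ i"]) (rule nar_g_functional_equation)
  also have "\<dots> = (nar_g ^ i + (1 + fps_const tt) * nar_g ^ Suc i
      + fps_const tt * nar_g ^ Suc (Suc i)) * fps_X"
    unfolding power_Suc by (simp add: algebra_simps)
  finally have "fps_shift 1 (nar_g ^ Suc i) = fps_shift 1 ((nar_g ^ i + (1 + fps_const tt) * nar_g ^ Suc i
      + fps_const tt * nar_g ^ Suc (Suc i)) * fps_X)"
    by (rule arg_cong)
  also have "\<dots> = nar_g ^ i + (1 + fps_const tt) * nar_g ^ Suc i + fps_const tt * nar_g ^ Suc (Suc i)"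
    by (rule fps_shift_times_fps_X')
  finally have "fps_shift 1 (nar_g ^ Suc i) = nar_g ^ i + (1 + fps_const tt) * nar_g ^ Suc i
      + fps_const tt * nar_g ^ Suc (Suc i)" .
  then show ?thesis
    unfolding shift_act_pCons c
    by (simp add: algebra_simps del: power_Suc fps_const_neg)
qed

lemma shift_act_chebT:
  "shift_act (chebT m) ((nar_g ^ m) ^ Suc i) =
    (nar_g ^ m) ^ i + fps_const (tt ^ m) * (nar_g ^ m) ^ Suc (Suc i)"
proof -
  have "(nar_g ^ m) ^ i = nar_g ^ (m * i)" "(nar_g ^ m) ^ Suc i = nar_g ^ (m * i + m)"
    "(nar_g ^ m) ^ Suc (Suc i) = nar_g ^ (m * i + 2 * m)"
    by (simp_all add: algebra_simps mult_2_right flip: power_mult power_add)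
  then show ?thesis
    using shift_act_dickson1[OF shift_act_nar_g, of m "m * i"] unfolding chebT_def by (simp only:)
qed

section \<open>Values and first-order coefficients at x = 0\<close>

lemma qnum_Suc: "qnum (Suc n) x = qnum n x + x ^ n" "qnum (Suc n) x = 1 + x * qnum n x"
proof -
  show "qnum (Suc n) x = qnum n x + x ^ n" by (simp add: qnum_def)
  show "qnum (Suc n) x = 1 + x * qnum n x"
    unfolding qnum_def sum.lessThan_Suc_shift by (simp add: sum_distrib_left)
qed

text \<open>The constant coefficient is 1/h + y h evaluated at g = -1. Both coefficients follow from
  the Dickson recurrence.\<close>

lemma coeff_chebT:
  "coeff (chebT m) 0 = (- 1) ^ m * (1 + tt ^ m)"
  "coeff (chebT m) 1 = - ((- 1) ^ m * of_nat m * qnum m tt)"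
proof -
  have "coeff (chebT m) 0 = (- 1) ^ m * (1 + tt ^ m) \<and>
    coeff (chebT m) 1 = - ((- 1) ^ m * of_nat m * qnum m tt)"
    unfolding chebT_def
  proof (induction m rule: less_induct)
    case (less m)
    consider "m = 0" | "m = 1" | k where "m = Suc (Suc k)"
      by (metis One_nat_def not0_implies_Suc)
    then show ?case
    proof cases
      case 1
      have "coeff (2 :: rat poly poly) 0 = 2" "coeff (2 :: rat poly poly) (Suc 0) = 0"
        by (metis coeff_pCons_0 numeral_poly) (metis coeff_pCons_Suc coeff_0 numeral_poly)
      then show ?thesis by (simp add: 1)
    next
      case 2
      then show ?thesis by (simp add: qnum_def)
    next
      case (3 k)
      \<comment> \<open>Eliminating powers of t in favour of q-numbers turns the induction step into
        a ring identity.\<close>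
      have geo: "tt ^ n = 1 - (1 - tt) * qnum n tt" for n
        using qnum_Suc[of n tt] by (simp add: algebra_simps)
      show ?thesis
        using less[of k] less[of "Suc k"]
        by (simp add: 3 qnum_Suc(1) geo del: power_Suc) (simp add: algebra_simps)
    qed
  qed
  then show "coeff (chebT m) 0 = (- 1) ^ m * (1 + tt ^ m)"
    "coeff (chebT m) 1 = - ((- 1) ^ m * of_nat m * qnum m tt)" by blast+
qed

text \<open>These are the three conditions on \<open>V\<close> in
  \<open>shift_act_dickson2\<close>.\<close>

lemma chebV_simps:
  "chebV m 0 = 0" "chebV m 1 = 1"
  "chebV m (Suc (Suc n)) = coeff (chebT m) 0 * chebV m (Suc n) - tt ^ m * chebV m n"
proof -
  have sq: "(- 1) ^ m * (- 1) ^ m = (1 :: rat poly)" by (simp flip: power_mult_distrib)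
  show "chebV m 0 = 0" by (simp add: chebV_def qnum_def)
  show "chebV m 1 = 1" by (simp add: chebV_def qnum_def power_add power2_eq_square sq)
  define s where "s = ((- 1) ^ m :: rat poly)"
  define e where "e = ((- 1) ^ (m * n) :: rat poly)"
  have ss: "s * (s * x) = x" for x using sq by (simp add: s_def flip: mult.assoc)
  have "chebV m (Suc (Suc n)) = e * s * qnum (Suc (Suc n)) (tt ^ m)"
    "chebV m (Suc n) = e * qnum (Suc n) (tt ^ m)" "chebV m n = e * s * qnum n (tt ^ m)"
    by (simp_all add: chebV_def power_add s_def[symmetric] e_def[symmetric] ss ac_simps)
  then show "chebV m (Suc (Suc n)) = coeff (chebT m) 0 * chebV m (Suc n) - tt ^ m * chebV m n"
    unfolding coeff_chebT s_def[symmetric] qnum_Suc(2)[of "Suc n"]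
    by (simp add: qnum_Suc(2)) (simp add: algebra_simps)
qed

lemma chebV_square: "(chebV m n)\<^sup>2 = (qnum n (tt ^ m))\<^sup>2"
  by (simp add: chebV_def power_mult_distrib flip: power_mult)

text \<open>The three-term recurrence multiplies this Casorati determinant by \<open>tt ^ m\<close>
  at every step.\<close>

lemma chebV_cassini: "(chebV m (Suc n))\<^sup>2 - chebV m (Suc (Suc n)) * chebV m n = (tt ^ m) ^ n"
proof (induction n)
  case 0
  then show ?case using chebV_simps(2) by (simp add: chebV_simps(1))
next
  case (Suc n)
  have "coeff (chebT m) 0 * chebV m (Suc n) = chebV m (Suc (Suc n)) + tt ^ m * chebV m n"
    by (simp add: chebV_simps(3))
  moreover have "(chebV m (Suc (Suc n)))\<^sup>2 - chebV m (Suc (Suc (Suc n))) * chebV m (Suc n) =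
      (chebV m (Suc (Suc n)))\<^sup>2 - chebV m (Suc (Suc n)) * (coeff (chebT m) 0 * chebV m (Suc n))
      + tt ^ m * (chebV m (Suc n))\<^sup>2"
    unfolding chebV_simps(3)[of m "Suc n"] by (simp add: power2_eq_square algebra_simps)
  ultimately have "(chebV m (Suc (Suc n)))\<^sup>2 - chebV m (Suc (Suc (Suc n))) * chebV m (Suc n) =
      tt ^ m * ((chebV m (Suc n))\<^sup>2 - chebV m (Suc (Suc n)) * chebV m n)"
    by (simp only:) (simp add: power2_eq_square algebra_simps)
  then show ?case unfolding Suc.IH by simp
qed

lemma monic_chebP:
  assumes "m > 0"
  shows "degree (chebP m n) = m * n" "coeff (chebP m n) (m * n) = 1"
proof -
  obtain k where k: "m = Suc k" using assms by (cases m) auto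
  have "degree (chebT m) = m \<and> lead_coeff (chebT m) = 1"
    using monic_dickson1[of "[:- (1 + tt), 1:]" 1 tt k] by (auto simp: chebT_def k)
  then have "degree (chebP m n) = m * n \<and> lead_coeff (chebP m n) = 1"
    unfolding chebP_def using assms by (intro monic_dickson2) auto
  then show "degree (chebP m n) = m * n" "coeff (chebP m n) (m * n) = 1" by auto
qed

lemma shift_act_chebP:
  "shift_act (chebP m n) (nar_g ^ m) =
    fps_const (chebV m n) + fps_const ((tt ^ m) ^ n) * (nar_g ^ m) ^ Suc n"
  unfolding chebP_def
  by (rule shift_act_dickson2[OF shift_act_chebT chebV_simps])

text \<open>Orthogonality of \<open>chebP m n\<close>: apart from the constant term, the series
  starts with the leading term of g^(m(n+1)).\<close>

lemma shift_act_chebP_nth: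
  assumes "m > 0"
  shows "fps_nth (shift_act (chebP m n) (nar_g ^ m)) 0 = chebV m n"
    and "0 < k \<Longrightarrow> k < m * Suc n \<Longrightarrow> fps_nth (shift_act (chebP m n) (nar_g ^ m)) k = 0"
    and "k = m * Suc n \<Longrightarrow> fps_nth (shift_act (chebP m n) (nar_g ^ m)) k = (tt ^ m) ^ n"
  using assms nar_g_power_nth(1)[of _ "m * Suc n"] nar_g_power_nth(2)[of "m * Suc n"]
  by (simp_all add: shift_act_chebP flip: power_mult del: power_Suc mult_Suc_right)

lemma coeff_chebP_0: "coeff (chebP m n) 0 = chebV m (Suc n)"
  unfolding chebP_def
  by (induction "chebT m" "tt ^ m" n rule: dickson2.induct)
    (use chebV_simps(2) in \<open>simp_all add: chebV_simps coeff_mult_0\<close>)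

text \<open>Confluent Christoffel-Darboux formula at x = 0. Call the left-hand side W_n; the
  recurrence and its derivative at 0 give W_(n+1) = y W_n + T'(0) V_(n+2)^2.\<close>

lemma coeff_chebP_1:
  "chebV m (Suc n) * coeff (chebP m (Suc n)) 1 - chebV m (Suc (Suc n)) * coeff (chebP m n) 1 =
    coeff (chebT m) 1 * (\<Sum>k\<le>n. (chebV m (Suc k))\<^sup>2 * (tt ^ m) ^ (n - k))"
proof (induction n)
  case 0
  then show ?case using chebV_simps(2) by (simp add: chebP_def)
next
  case (Suc n)
  let ?y = "tt ^ m"
  have P: "coeff (chebP m (Suc (Suc n))) 1 = coeff (chebT m) 0 * coeff (chebP m (Suc n)) 1
      + coeff (chebT m) 1 * chebV m (Suc (Suc n)) - ?y * coeff (chebP m n) 1"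
    unfolding coeff_chebP_0[symmetric] by (simp add: chebP_def coeff_mult)
  have "(\<Sum>k\<le>Suc n. (chebV m (Suc k))\<^sup>2 * ?y ^ (Suc n - k)) =
      (chebV m (Suc (Suc n)))\<^sup>2 + ?y * (\<Sum>k\<le>n. (chebV m (Suc k))\<^sup>2 * ?y ^ (n - k))"
    by (simp add: sum_distrib_left Suc_diff_le algebra_simps)
  then have "coeff (chebT m) 1 * (\<Sum>k\<le>Suc n. (chebV m (Suc k))\<^sup>2 * ?y ^ (Suc n - k)) =
      coeff (chebT m) 1 * (chebV m (Suc (Suc n)))\<^sup>2 + ?y * (chebV m (Suc n) * coeff (chebP m (Suc n)) 1
        - chebV m (Suc (Suc n)) * coeff (chebP m n) 1)"
    unfolding Suc.IH by (simp add: algebra_simps)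
  also have "\<dots> = chebV m (Suc (Suc n)) * coeff (chebP m (Suc (Suc n))) 1
      - chebV m (Suc (Suc (Suc n))) * coeff (chebP m (Suc n)) 1"
    unfolding P chebV_simps(3)[of m "Suc n"] by (simp add: power2_eq_square algebra_simps)
  finally show ?case by simp
qed

section \<open>Squares of q-numbers and the polynomial R\<close>

text \<open>The coefficients of the square are 1, 2, ..., n+1, ..., 2, 1; the falling half is
  indexed by its distance from the top degree. The induction squares [n+2] = 1 + y [n+1].\<close>

lemma qnum_square:
  "(qnum (Suc n) y)\<^sup>2 = (\<Sum>i\<le>n. of_nat (i + 1) * y ^ i) + (\<Sum>j<n. of_nat (j + 1) * y ^ (2 * n - j))"
proof (induction n)
  case (Suc n)
  define A where "A = (\<lambda>n. \<Sum>i\<le>n. of_nat (i + 1) * y ^ i)"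
  \<comment> \<open>The left-hand side is the rising half for \<open>Suc n\<close> together with the
    one new term of the falling half.\<close>
  have A: "A n + of_nat (n + 2) * y ^ (n + 1) + of_nat (n + 1) * y ^ (n + 2) =
      1 + 2 * y * qnum (Suc n) y + y\<^sup>2 * A n" for n
  proof (induction n)
    case (Suc n)
    have "A (Suc n) = A n + of_nat (n + 2) * y ^ (n + 1)" by (simp add: A_def)
    then have "A (Suc n) + of_nat (Suc n + 2) * y ^ (Suc n + 1) + of_nat (Suc n + 1) * y ^ (Suc n + 2) =
      A n + of_nat (n + 2) * y ^ (n + 1) + of_nat (n + 1) * y ^ (n + 2)
      + 2 * y ^ (n + 2) + of_nat (n + 2) * y ^ (n + 3)"
      by (simp add: algebra_simps eval_nat_numeral)
    also have "\<dots> = 1 + 2 * y * qnum (Suc (Suc n)) y + y\<^sup>2 * A (Suc n)"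
      unfolding Suc.IH qnum_Suc(1)[of "Suc n"] \<open>A (Suc n) = _\<close>
      by (simp add: algebra_simps eval_nat_numeral)
    finally show ?case .
  qed (simp add: A_def qnum_def power2_eq_square)
  have "(\<Sum>j<Suc n. of_nat (j + 1) * y ^ (2 * Suc n - j)) =
      (\<Sum>j<n. of_nat (j + 1) * y ^ (2 + (2 * n - j))) + of_nat (n + 1) * y ^ (n + 2)"
    by (simp add: Suc_diff_le)
  then have B: "(\<Sum>j<Suc n. of_nat (j + 1) * y ^ (2 * Suc n - j)) =
      y\<^sup>2 * (\<Sum>j<n. of_nat (j + 1) * y ^ (2 * n - j)) + of_nat (n + 1) * y ^ (n + 2)"
    unfolding power_add by (simp add: sum_distrib_left ac_simps)
  have "(qnum (Suc (Suc n)) y)\<^sup>2 = 1 + 2 * y * qnum (Suc n) y + y\<^sup>2 * (qnum (Suc n) y)\<^sup>2"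
    unfolding qnum_Suc(2)[of "Suc n"] by (simp add: power2_eq_square algebra_simps)
  also have "\<dots> = (1 + 2 * y * qnum (Suc n) y + y\<^sup>2 * A n)
      + y\<^sup>2 * (\<Sum>j<n. of_nat (j + 1) * y ^ (2 * n - j))"
    unfolding Suc.IH A_def by (simp only: algebra_simps)
  also have "\<dots> = A (Suc n) + (\<Sum>j<Suc n. of_nat (j + 1) * y ^ (2 * Suc n - j))"
    unfolding A[symmetric] B by (simp add: A_def)
  finally show ?case unfolding A_def .
qed (simp add: qnum_def)

text \<open>The left-hand side S_n satisfies S_(n+1) = [n+2]^2 + y S_n. Summing 1, 2, 3, ... inwards
  from either end gives triangular numbers; \<open>A\<close> and \<open>B\<close> are this
  recurrence for the two halves.\<close>

lemma qnum_square_convolution: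
  "(\<Sum>k\<le>n. (qnum (Suc k) y)\<^sup>2 * y ^ (n - k)) =
    (\<Sum>i=0..n. of_nat ((i + 2) choose 2) * y ^ i)
      + (\<Sum>i=n+1..2*n. of_nat ((2 * n - i + 2) choose 2) * y ^ i)"
proof -
  define c where "c = (\<lambda>i. of_nat ((i + 2) choose 2) :: rat poly)"
  have c: "c (Suc i) = c i + of_nat (Suc i + 1)" for i
    by (simp add: c_def eval_nat_numeral)
  have c0: "c 0 = 1" by (simp add: c_def numeral_2_eq_2)
  have A: "(\<Sum>i\<le>n. c i * y ^ i) = (\<Sum>i\<le>n. of_nat (i + 1) * y ^ i) + y * (\<Sum>i<n. c i * y ^ i)" for n
    by (induction n) (simp_all add: c c0 algebra_simps)
  have B: "(\<Sum>j<Suc n. c j * y ^ (2 * Suc n - j)) =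
      y * (\<Sum>j<n. c j * y ^ (2 * n - j)) + (\<Sum>j<Suc n. of_nat (j + 1) * y ^ (2 * Suc n - j))" for n
  proof -
    have "(\<Sum>j<Suc n. c j * y ^ (2 * Suc n - j)) = y ^ (2 * Suc n) + (\<Sum>j<n. c (Suc j) * y ^ (2 * Suc n - Suc j))"
      unfolding sum.lessThan_Suc_shift c0 by simp
    also have "(\<Sum>j<n. c (Suc j) * y ^ (2 * Suc n - Suc j)) =
      (\<Sum>j<n. c j * (y * y ^ (2 * n - j))) + (\<Sum>j<n. of_nat (Suc j + 1) * y ^ (2 * Suc n - Suc j))"
      unfolding sum.distrib[symmetric] by (intro sum.cong) (simp_all add: c Suc_diff_le algebra_simps)
    also have "y ^ (2 * Suc n) + ((\<Sum>j<n. c j * (y * y ^ (2 * n - j)))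
        + (\<Sum>j<n. of_nat (Suc j + 1) * y ^ (2 * Suc n - Suc j))) =
      (\<Sum>j<n. c j * (y * y ^ (2 * n - j))) + (\<Sum>j<Suc n. of_nat (j + 1) * y ^ (2 * Suc n - j))"
      unfolding sum.lessThan_Suc_shift by simp
    finally show ?thesis by (simp add: sum_distrib_left ac_simps)
  qed
  have "(\<Sum>k\<le>n. (qnum (Suc k) y)\<^sup>2 * y ^ (n - k)) = (\<Sum>i\<le>n. c i * y ^ i) + (\<Sum>j<n. c j * y ^ (2 * n - j))"
  proof (induction n)
    case (Suc n)
    have "(\<Sum>k\<le>Suc n. (qnum (Suc k) y)\<^sup>2 * y ^ (Suc n - k)) =
        (qnum (Suc (Suc n)) y)\<^sup>2 + y * (\<Sum>k\<le>n. (qnum (Suc k) y)\<^sup>2 * y ^ (n - k))"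
      by (simp add: sum_distrib_left Suc_diff_le algebra_simps)
    then show ?case
      unfolding Suc.IH qnum_square[of "Suc n"] B A[of "Suc n", unfolded lessThan_Suc_atMost]
      by (simp only: distrib_left ac_simps)
  qed (simp add: c0 qnum_def)
  moreover have "(\<Sum>j<n. c j * y ^ (2 * n - j)) = (\<Sum>i=n+1..2*n. c (2 * n - i) * y ^ i)"
    by (rule sum.reindex_bij_witness[of _ "\<lambda>i. 2 * n - i" "\<lambda>j. 2 * n - j"]) auto
  ultimately show ?thesis by (simp add: c_def atLeast0AtMost)
qed

lemma coeff_chebP_1_Rpoly:
  assumes "m > 0"
  shows "chebV m (Suc n) * coeff (chebP m (Suc n)) 1 - chebV m (Suc (Suc n)) * coeff (chebP m n) 1 =
    (- 1) ^ (m - 1) * Rpoly m n"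
proof -
  have "- ((- 1) ^ m) = ((- 1) ^ (m - 1) :: rat poly)" using assms by (cases m) auto
  then show ?thesis
    unfolding coeff_chebP_1 chebV_square qnum_square_convolution coeff_chebT Rpoly_def power_mult
    by (simp add: mult.assoc flip: mult_minus_left)
qed

subsection \<open>Hankel determinants\<close>

text \<open>The convention that negative indices give 0 agrees with the vanishing of the
  coefficients of g^m below q^m.\<close>

lemma gamma2m_eq: "gamma2m m (int i + int j + 3 - int m) = fps_nth (nar_g ^ m) (i + j + 3)"
proof (cases "i + j + 3 < m")
  case True
  then have "int i + int j + 3 - int m < 0" by linarith
  then show ?thesis using True by (simp add: gamma2m_def nar_g_power_nth)
next
  case False
  then have "nat (int i + int j + 3 - int m) + m = i + j + 3" by linarith
  moreover have "\<not> int i + int j + 3 - int m < 0" using False by linarith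
  ultimately show ?thesis by (simp add: gamma2m_def nar_g_def)
qed

lemma hankelH_eq: "hankelH m N = det (mat N N (\<lambda>(i, j). fps_nth (nar_g ^ m) (i + j + 3)))"
  by (simp add: hankelH_def gamma2m_eq)

text \<open>Passing from \<open>n\<close> to \<open>Suc n\<close>, the last \<open>m\<close> columns
  are replaced by the combinations with coefficient vectors x^r \<open>chebP m n\<close>, r < m.
  Orthogonality clears these columns in the first \<open>m * n\<close> rows and leaves an
  anti-triangular block with antidiagonal y^n.\<close>

lemma det_nar_g_hankel:
  assumes "m > 0"
  shows "det (mat (m * n) (m * n) (\<lambda>(i, j). fps_nth (nar_g ^ m) (i + j + 1))) =
    ((- 1) ^ (m * (m - 1) div 2)) ^ n * tt ^ (m\<^sup>2 * (n * (n - 1) div 2))"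
proof (induction n)
  case (Suc n)
  let ?N = "m * n + m"
  \<comment> \<open>\<open>E\<close> is upper unitriangular because \<open>chebP m n\<close> is
    monic of degree \<open>m * n\<close>.\<close>
  define E where "E = (\<lambda>k j. if j < m * n then if k = j then 1 else 0
    else coeff (monom 1 (j - m * n) * chebP m n) k)"
  define B where "B = (\<lambda>i j. \<Sum>k<?N. fps_nth (nar_g ^ m) (i + k + 1) * E k j)"
  have B1: "B i j = fps_nth (nar_g ^ m) (i + j + 1)" if "j < m * n" for i j
    using that by (simp add: B_def E_def if_distrib [of "(*) _"] cong: if_cong)
  have B2: "B i (m * n + r) = fps_nth (shift_act (chebP m n) (nar_g ^ m)) (i + 1 + r)" if "r < m" for i r
  proof -
    have "degree (monom 1 r * chebP m n) < ?N"
      using degree_mult_le[of "monom 1 r" "chebP m n"] that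
      by (simp add: monic_chebP[OF assms] degree_monom_eq)
    then have "B i (m * n + r) = fps_nth (shift_act (monom 1 r * chebP m n) (nar_g ^ m)) (i + 1)"
      by (simp add: B_def E_def shift_act_nth_less ac_simps)
    then show ?thesis by (simp only: shift_act_monom_mult_nth)
  qed
  have det_E: "det (mat ?N ?N (\<lambda>(i, j). E i j)) = 1"
  proof -
    have z: "E i j = 0" if "j < i" "i < ?N" for i j
    proof -
      have "i - (j - m * n) > m * n" if "\<not> j < m * n" using that \<open>j < i\<close> by linarith
      then show ?thesis
        using that by (auto simp: E_def coeff_monom_mult coeff_eq_0 monic_chebP[OF assms])
    qed
    have d: "E i i = 1" for i
    proof (cases "i < m * n")
      case False
      then have "i - (i - m * n) = m * n" by linarith
      then show ?thesis using False monic_chebP[OF assms] by (simp add: E_def coeff_monom_mult)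
    qed (simp add: E_def)
    have "det (mat ?N ?N (\<lambda>(i, j). E i j)) = prod_list (diag_mat (mat ?N ?N (\<lambda>(i, j). E i j)))"
      by (rule det_upper_triangular[of _ ?N]) (auto simp: z)
    also have "\<dots> = 1" by (simp add: prod_list_diag_prod d)
    finally show ?thesis .
  qed
  let ?A = "mat (m * n) (m * n) (\<lambda>(i, j). fps_nth (nar_g ^ m) (i + j + 1))"
  let ?D = "mat m m (\<lambda>(i, j). B (m * n + i) (m * n + j))"
  have "mat ?N ?N (\<lambda>(i, j). B i j) = four_block_mat ?A (0\<^sub>m (m * n) m)
      (mat m (m * n) (\<lambda>(i, j). B (m * n + i) j)) ?D"
  proof (rule eq_matI)
    fix i j
    assume ij: "i < dim_row (four_block_mat ?A (0\<^sub>m (m * n) m) (mat m (m * n) (\<lambda>(i, j). B (m * n + i) j)) ?D)"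
      "j < dim_col (four_block_mat ?A (0\<^sub>m (m * n) m) (mat m (m * n) (\<lambda>(i, j). B (m * n + i) j)) ?D)"
    then have ij': "i < ?N" "j < ?N" by simp_all
    have "B i j = 0" if "i < m * n" "m * n \<le> j"
    proof -
      from \<open>m * n \<le> j\<close> obtain r where "j = m * n + r" by (rule less_eqE)
      then show ?thesis
        using that ij' B2[of r i] shift_act_chebP_nth(2)[OF assms, of "i + 1 + r" n] by simp
    qed
    then show "mat ?N ?N (\<lambda>(i, j). B i j) $$ (i, j) = four_block_mat ?A (0\<^sub>m (m * n) m)
      (mat m (m * n) (\<lambda>(i, j). B (m * n + i) j)) ?D $$ (i, j)"
      using ij' B1 by auto
  qed simp_all
  then have block: "det (mat ?N ?N (\<lambda>(i, j). B i j)) = det ?A * det ?D"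
    by (simp only:) (rule det_four_block_mat_upper_right_zero, auto)
  have D: "det ?D = (- 1) ^ (m * (m - 1) div 2) * ((tt ^ m) ^ n) ^ m"
  proof (rule det_anti_triangular)
    show "B (m * n + i) (m * n + j) = 0" if "i + j + 1 < m" for i j
      using that B2[of j "m * n + i"] shift_act_chebP_nth(2)[OF assms, of "m * n + i + 1 + j" n] by simp
    show "B (m * n + i) (m * n + j) = (tt ^ m) ^ n" if "i + j + 1 = m" for i j
      using that B2[of j "m * n + i"] shift_act_chebP_nth(3)[OF assms, of "m * n + i + 1 + j" n]
      by (simp add: algebra_simps)
  qed
  have "det (mat ?N ?N (\<lambda>(i, j). B i j)) =
      det (mat ?N ?N (\<lambda>(i, j). fps_nth (nar_g ^ m) (i + j + 1)))"
    unfolding B_def using det_mat_times_mat[of ?N "\<lambda>i j. fps_nth (nar_g ^ m) (i + j + 1)" E] det_E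
    by simp
  then have BA: "det (mat (m * Suc n) (m * Suc n) (\<lambda>(i, j). fps_nth (nar_g ^ m) (i + j + 1))) = det ?A * det ?D"
    unfolding block by (simp add: add.commute)
  have tt: "tt ^ (m\<^sup>2 * (Suc n * (Suc n - 1) div 2)) =
      tt ^ (m\<^sup>2 * (n * (n - 1) div 2)) * ((tt ^ m) ^ n) ^ m"
  proof -
    have "Suc n * (Suc n - 1) div 2 = n * (n - 1) div 2 + n"
      by (cases n) (auto simp: algebra_simps)
    then show ?thesis
      by (simp add: power2_eq_square algebra_simps flip: power_mult power_add)
  qed
  show ?case
    unfolding BA D Suc.IH tt power_Suc by (simp only: ac_simps)
qed simp

text \<open>As \<open>m * (m - 1)\<close> is even, halving commutes with multiplication by
  \<open>n\<close>.\<close>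

lemma xi1_eq: "xi1 m n = ((- 1) ^ (m * (m - 1) div 2)) ^ n"
proof -
  have "n * m * (m - 1) div 2 = m * (m - 1) div 2 * n"
    by (metis dvd_div_mult even_mult_iff even_diff_nat even_Suc mult.assoc mult.commute odd_one even_add)
  then show ?thesis by (simp add: xi1_def flip: power_mult)
qed

lemma hankelH_mult:
  assumes "m \<ge> 3"
  shows "hankelH m (m * n) = xi1 m n * tt ^ (m\<^sup>2 * (n * (n - 1) div 2)) * (qnum (n + 1) (tt ^ m))\<^sup>2"
proof (cases "n = 0")
  case True
  then show ?thesis by (simp add: hankelH_eq xi1_def qnum_def)
next
  case False
  have m: "m > 0" using assms by simp
  let ?N = "m * n"
  have N: "?N > 0" using False m by simp
  \<comment> \<open>The two companion steps use this relation for indices up to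
    \<open>m * n + 1\<close>, which is below \<open>m * Suc n\<close>.\<close>
  have rel: "(\<Sum>k<?N. coeff (chebP m n) k * fps_nth (nar_g ^ m) (i + k)) = - fps_nth (nar_g ^ m) (i + ?N)"
    if "0 < i" "i < m * Suc n" for i
  proof -
    have "(\<Sum>k\<le>?N. coeff (chebP m n) k * fps_nth (nar_g ^ m) (i + k)) = 0"
      using shift_act_chebP_nth(2)[OF m that] shift_act_nth[of "chebP m n" ?N] by (simp add: monic_chebP[OF m])
    then show ?thesis
      unfolding lessThan_Suc_atMost[symmetric] using monic_chebP(2)[OF m, of n]
      by (simp add: add_eq_0_iff2)
  qed
  have "det (mat ?N ?N (\<lambda>(i, j). fps_nth (nar_g ^ m) (i + j + s + 1))) =
      (- 1) ^ ?N * chebV m (Suc n) * det (mat ?N ?N (\<lambda>(i, j). fps_nth (nar_g ^ m) (i + j + s)))"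
    if s: "s \<in> {1, 2}" for s
  proof -
    have "(\<Sum>k<?N. coeff (chebP m n) k * fps_nth (nar_g ^ m) (i + k + s)) = - fps_nth (nar_g ^ m) (i + ?N + s)"
      if "i < ?N" for i
      using rel[of "i + s"] that s assms by (auto simp: ac_simps)
    from det_hankel_shift[OF this N] show ?thesis by (simp add: coeff_chebP_0 ac_simps)
  qed
  from this[of 1] this[of 2] have "hankelH m ?N = ((- 1) ^ ?N * (- 1) ^ ?N) * (chebV m (Suc n))\<^sup>2 *
      det (mat ?N ?N (\<lambda>(i, j). fps_nth (nar_g ^ m) (i + j + 1)))"
    by (simp add: hankelH_eq power2_eq_square numeral_3_eq_3 numeral_2_eq_2)
  also have "(- 1) ^ ?N * (- 1) ^ ?N = (1 :: rat poly)" by (simp flip: power_mult_distrib)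
  finally show ?thesis
    unfolding det_nar_g_hankel[OF m] chebV_square xi1_eq by simp
qed

text \<open>The polynomial \<open>w / x\<close> is (up to \<open>y^n\<close>) the reproducing kernel at \<open>x = 0\<close> in
  Christoffel-Darboux form; its coefficient vector is a multiple of the first column of the
  inverse Hankel matrix.\<close>

lemma hankel_dual_vector:
  assumes "m > 0" "i < m * Suc n"
  defines "w \<equiv> smult (chebV m (Suc n)) (chebP m (Suc n)) - smult (chebV m (Suc (Suc n))) (chebP m n)"
  shows "(\<Sum>k<m * Suc n. fps_nth (nar_g ^ m) (i + k + 1) * coeff w (Suc k)) =
    (if i = 0 then (tt ^ m) ^ n else 0)"
proof -
  let ?N = "m * Suc n"
  have "degree w \<le> ?N"
    unfolding w_def
    by (intro degree_diff_le order.trans[OF degree_smult_le]) (simp_all add: monic_chebP[OF assms(1)])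
  have w0: "coeff w 0 = 0" by (simp add: w_def coeff_chebP_0)
  have "fps_nth (shift_act w (nar_g ^ m)) i = (\<Sum>k\<le>?N. coeff w k * fps_nth (nar_g ^ m) (i + k))"
    using \<open>degree w \<le> ?N\<close> by (rule shift_act_nth)
  also have "\<dots> = (\<Sum>k<Suc ?N. coeff w k * fps_nth (nar_g ^ m) (i + k))"
    by (simp only: lessThan_Suc_atMost)
  also have "\<dots> = (\<Sum>k<?N. fps_nth (nar_g ^ m) (i + k + 1) * coeff w (Suc k))"
    unfolding sum.lessThan_Suc_shift by (simp add: w0 mult.commute)
  finally have "(\<Sum>k<?N. fps_nth (nar_g ^ m) (i + k + 1) * coeff w (Suc k)) =
      fps_nth (shift_act w (nar_g ^ m)) i" ..
  also have "\<dots> = (if i = 0 then (tt ^ m) ^ n else 0)"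
    using chebV_cassini[of m n] assms(1,2) shift_act_chebP_nth(2)[OF assms(1), of i n]
      shift_act_chebP_nth(2)[OF assms(1), of i "Suc n"]
    by (simp add: w_def shift_act_diff shift_act_smult shift_act_chebP_nth(1)[OF assms(1)] power2_eq_square)
  finally show ?thesis .
qed

text \<open>Deleting the first row and column turns index i + j + 1 into i + j + 3. The factor y^n
  comes from the dual vector and stays on the left, to be cancelled at the end.\<close>

lemma hankelH_mult_minus_1:
  assumes "m > 0"
  shows "(tt ^ m) ^ n * hankelH m (m * Suc n - 1) =
    xi1 m (Suc n) * tt ^ (m\<^sup>2 * (Suc n * n div 2)) * ((- 1) ^ (m - 1) * Rpoly m n)"
proof -
  define w where "w = smult (chebV m (Suc n)) (chebP m (Suc n)) - smult (chebV m (Suc (Suc n))) (chebP m n)"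
  obtain N where N: "m * Suc n = Suc N" using assms by (metis gr0_implies_Suc nat_0_less_mult_iff zero_less_Suc)
  have "(\<Sum>k\<le>N. fps_nth (nar_g ^ m) (i + k + 1) * coeff w (Suc k)) = (if i = 0 then (tt ^ m) ^ n else 0)"
    if "i \<le> N" for i
    using hankel_dual_vector[OF assms, of i n] that unfolding N lessThan_Suc_atMost w_def by simp
  from cramer_first[OF this] have "(tt ^ m) ^ n * hankelH m N =
      det (mat (m * Suc n) (m * Suc n) (\<lambda>(i, j). fps_nth (nar_g ^ m) (i + j + 1))) * coeff w 1"
    unfolding N by (simp add: hankelH_eq numeral_3_eq_3)
  also have "coeff w 1 = (- 1) ^ (m - 1) * Rpoly m n"
    using coeff_chebP_1_Rpoly[OF assms, of n] by (simp add: w_def)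
  moreover have "m * Suc n - 1 = N" by (simp only: N diff_Suc_1)
  ultimately show ?thesis unfolding det_nar_g_hankel[OF assms] xi1_eq by (simp only: diff_Suc_1)
qed

text \<open>The last column of the inverse is proportional to \<open>chebP m n\<close>. The two
  corner entries required, the leading coefficient of \<open>w\<close> and the constant coefficient
  of \<open>chebP m n\<close>, both equal \<open>chebV m (Suc n)\<close>.\<close>

lemma hankelH_mult_minus_2:
  assumes "m \<ge> 3"
  shows "((tt ^ m) ^ n)\<^sup>2 * hankelH m (m * Suc n - 2) =
    - xi1 m (Suc n) * tt ^ (m\<^sup>2 * (Suc n * n div 2)) * (qnum (Suc n) (tt ^ m))\<^sup>2"
proof -
  have m: "m > 0" using assms by simp
  define w where "w = smult (chebV m (Suc n)) (chebP m (Suc n)) - smult (chebV m (Suc (Suc n))) (chebP m n)"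
  define N where "N = m * Suc n - 2"
  have N: "m * Suc n = Suc (Suc N)" using assms by (simp add: N_def)
  \<comment> \<open>Hence \<open>chebP m n\<close> has no coefficient at the last index, the
    vanishing corner demanded by \<open>cramer_first_last\<close>.\<close>
  have lt: "m * n < Suc N" using N assms by simp
  have w: "(\<Sum>k\<le>Suc N. fps_nth (nar_g ^ m) (i + k + 1) * coeff w (Suc k)) = (if i = 0 then (tt ^ m) ^ n else 0)"
    if "i \<le> Suc N" for i
    using hankel_dual_vector[OF m, of i n] that unfolding N lessThan_Suc_atMost w_def by simp
  have P: "(\<Sum>k\<le>Suc N. fps_nth (nar_g ^ m) (i + k + 1) * coeff (chebP m n) k) =
      (if i = Suc N then (tt ^ m) ^ n else 0)" if "i \<le> Suc N" for i
  proof -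
    have "(\<Sum>k\<le>Suc N. fps_nth (nar_g ^ m) (i + k + 1) * coeff (chebP m n) k) =
      fps_nth (shift_act (chebP m n) (nar_g ^ m)) (i + 1)"
      using shift_act_nth[of "chebP m n" "Suc N" "nar_g ^ m" "i + 1"] lt
      by (simp add: monic_chebP[OF m] ac_simps)
    then show ?thesis
      using shift_act_chebP_nth(2,3)[OF m, of "i + 1" n] that N by auto
  qed
  have 0: "coeff (chebP m n) (Suc N) = 0"
    using lt by (intro coeff_eq_0) (simp add: monic_chebP[OF m])
  have "coeff w (Suc (Suc N)) = chebV m (Suc n)"
    using monic_chebP[OF m, of "Suc n"] monic_chebP[OF m, of n] lt unfolding N
    by (simp add: w_def coeff_eq_0)
  with cramer_first_last[OF w P 0] have "((tt ^ m) ^ n)\<^sup>2 * hankelH m N =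
      - det (mat (m * Suc n) (m * Suc n) (\<lambda>(i, j). fps_nth (nar_g ^ m) (i + j + 1))) * (chebV m (Suc n))\<^sup>2"
    unfolding N by (simp add: hankelH_eq numeral_3_eq_3 coeff_chebP_0 power2_eq_square)
  then show ?thesis unfolding det_nar_g_hankel[OF m] xi1_eq chebV_square N_def by simp
qed

text \<open>The coefficient vector of \<open>chebP m n\<close> fits into \<open>N\<close> entries
  with its leading 1, and the row indices 3, ..., N + 2 all lie in the range of
  orthogonality.\<close>

lemma hankelH_zero:
  assumes "m * n < N" "N + 2 < m * Suc n"
  shows "hankelH m N = 0"
proof -
  have m: "m > 0" using assms by (cases m) auto
  let ?A = "mat N N (\<lambda>(i, j). fps_nth (nar_g ^ m) (i + j + 3))"
  let ?v = "vec N (coeff (chebP m n))"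
  have "?v $ (m * n) \<noteq> 0\<^sub>v N $ (m * n)" using assms monic_chebP[OF m] by simp
  then have "?v \<noteq> 0\<^sub>v N" by metis
  moreover have "?A *\<^sub>v ?v = 0\<^sub>v N"
  proof (rule eq_vecI)
    fix i assume "i < dim_vec (0\<^sub>v N :: rat poly vec)"
    then have i: "i < N" by simp
    have "(?A *\<^sub>v ?v) $ i = (\<Sum>k<N. fps_nth (nar_g ^ m) (i + k + 3) * coeff (chebP m n) k)"
      using i by (simp add: scalar_prod_def atLeast0LessThan)
    also have "\<dots> = fps_nth (shift_act (chebP m n) (nar_g ^ m)) (i + 3)"
      using assms shift_act_nth_less[of "chebP m n" N] by (simp add: monic_chebP[OF m] ac_simps)
    also have "\<dots> = 0" using i assms by (intro shift_act_chebP_nth(2)[OF m]) auto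
    finally show "(?A *\<^sub>v ?v) $ i = 0\<^sub>v N $ i" using i by simp
  qed simp
  moreover have "?v \<in> carrier_vec N" "?A \<in> carrier_mat N N" by simp_all
  ultimately show ?thesis
    unfolding hankelH_eq using det_0_iff_vec_prod_zero by blast
qed

theorem theorem1p7:
  fixes m :: nat
  assumes "m \<ge> 3"
  shows "(\<forall>n. hankelH m (m * n) =
            xi1 m n * tt ^ (m^2 * n * (n - 1) div 2) * (qnum (n + 1) (tt ^ m))^2)
       \<and> (\<forall>n\<ge>1. hankelH m (m * n - 1) =
            (-1) ^ (m - 1) * xi1 m n * tt ^ (m * (n - 1) * (m * n - 2) div 2) * Rpoly m (n - 1))
       \<and> (\<forall>n\<ge>1. hankelH m (m * n - 2) =
            - xi1 m n * tt ^ (m * (n - 1) * (m * n - 4) div 2) * (qnum n (tt ^ m))^2)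
       \<and> (\<forall>N. (\<forall>n. N \<noteq> m * n \<and> N + 1 \<noteq> m * n \<and> N + 2 \<noteq> m * n) \<longrightarrow> hankelH m N = 0)"
proof (intro conjI allI impI)
  have m: "m > 0" using assms by simp
  have tt: "tt \<noteq> 0" by (simp add: tt_def)
  have half: "m\<^sup>2 * n * (n - 1) div 2 = m\<^sup>2 * (n * (n - 1) div 2)" for n
  proof -
    have "2 dvd n * (n - 1)" by (cases n) auto
    then show ?thesis by (simp add: mult.assoc div_mult_swap)
  qed
  show "hankelH m (m * n) = xi1 m n * tt ^ (m^2 * n * (n - 1) div 2) * (qnum (n + 1) (tt ^ m))^2" for n
    unfolding half by (rule hankelH_mult[OF assms])
  fix n :: nat assume "n \<ge> 1"
  then obtain k where k: "n = Suc k" by (cases n) auto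
  \<comment> \<open>The subtraction truncates only if \<open>k = 0\<close>, where the factor
    \<open>k\<close> makes both sides 0; for \<open>k > 0\<close> the product
    \<open>m * Suc k\<close> is at least 6.\<close>
  have aux: "m * k * (m * Suc k - c) + c * (m * k) = m\<^sup>2 * (Suc k * k)" if "c \<le> 4" for c
  proof (cases k)
    case (Suc l)
    have "m * Suc k \<ge> 3 * 2" using assms Suc by (intro mult_le_mono) auto
    then have "m * Suc k - c + c = m * Suc k" using that by simp
    then have "m * k * (m * Suc k - c) + c * (m * k) = m * k * (m * Suc k)"
      unfolding mult.commute[of c] distrib_left[symmetric] by (simp only:)
    then show ?thesis by (simp only: power2_eq_square ac_simps)
  qed simp
  define e where "e = Suc k * k div 2"
  have e: "Suc k * k = 2 * e" by (simp add: e_def)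
  show "hankelH m (m * n - 1) =
      (-1) ^ (m - 1) * xi1 m n * tt ^ (m * (n - 1) * (m * n - 2) div 2) * Rpoly m (n - 1)"
  proof -
    have "m * k * (m * Suc k - 2) + 2 * (m * k) = m\<^sup>2 * (Suc k * k)"
      by (rule aux) simp
    then have "m * k * (m * Suc k - 2) div 2 + m * k = m\<^sup>2 * e"
      unfolding e by linarith
    then have p: "tt ^ (m\<^sup>2 * e) = (tt ^ m) ^ k * tt ^ (m * k * (m * Suc k - 2) div 2)"
      unfolding power_mult[symmetric] power_add[symmetric] by (simp add: add.commute)
    have "(tt ^ m) ^ k * hankelH m (m * n - 1) =
        (tt ^ m) ^ k * ((-1) ^ (m - 1) * xi1 m n * tt ^ (m * (n - 1) * (m * n - 2) div 2) * Rpoly m (n - 1))"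
      using hankelH_mult_minus_1[OF m, of k]
      unfolding e_def[symmetric] p k diff_Suc_1 by (simp only: ac_simps)
    then show ?thesis using tt by simp
  qed
  show "hankelH m (m * n - 2) = - xi1 m n * tt ^ (m * (n - 1) * (m * n - 4) div 2) * (qnum n (tt ^ m))^2"
  proof -
    have "m * k * (m * Suc k - 4) + 4 * (m * k) = m\<^sup>2 * (Suc k * k)"
      by (rule aux) simp
    then have "m * k * (m * Suc k - 4) div 2 + 2 * (m * k) = m\<^sup>2 * e"
      unfolding e by linarith
    then have p: "tt ^ (m\<^sup>2 * e) = ((tt ^ m) ^ k)\<^sup>2 * tt ^ (m * k * (m * Suc k - 4) div 2)"
      unfolding power_mult[symmetric] power_add[symmetric] by (simp add: ac_simps)
    have "((tt ^ m) ^ k)\<^sup>2 * hankelH m (m * n - 2) =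
        ((tt ^ m) ^ k)\<^sup>2 * (- xi1 m n * tt ^ (m * (n - 1) * (m * n - 4) div 2) * (qnum n (tt ^ m))^2)"
      using hankelH_mult_minus_2[OF assms, of k]
      unfolding e_def[symmetric] p k diff_Suc_1 by (simp only: ac_simps mult_minus_left mult_minus_right)
    moreover have "((tt ^ m) ^ k)\<^sup>2 \<noteq> 0" using tt by simp
    ultimately show ?thesis by (simp only: mult_cancel_left) simp
  qed
next
  fix N assume N: "\<forall>n. N \<noteq> m * n \<and> N + 1 \<noteq> m * n \<and> N + 2 \<noteq> m * n"
  \<comment> \<open>Excluding the three residues leaves \<open>N\<close> strictly between
    \<open>m * n\<close> and \<open>m * Suc n - 2\<close>.\<close>
  define n where "n = N div m"
  have "m * n \<le> N" "N < m * Suc n"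
    using assms by (simp_all add: n_def dividend_less_times_div)
  moreover have "N \<noteq> m * n" "N + 1 \<noteq> m * Suc n" "N + 2 \<noteq> m * Suc n" using N by blast+
  ultimately show "hankelH m N = 0" by (intro hankelH_zero[of m n]) linarith+
qed

end
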